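(* Let $E\subset Z$ be an $N$-dimensional affine subspace of $Z$, let $\Phi:Z\to\mathbb{R}$ be a Borel function, and let $$\mu = \big(e^{-\Phi}\,\mathcal{L}^{2N}\big)\times\big(\mathcal{H}^N\llcorner E\big)$$ on $Z\times Z$. Assume that $\beta_0>0$, $c>0$ and $b>0$ are constants such that $$\beta_0\|y-z\|^2+\Phi(y)\ \ge\ c\big(\|y\|^2+\|z\|^2\big)-b\qquad\text{for all } y\in Z,\ z\in E .$$ Let $E_0$ be the linear subspace parallel to $E$, let $E_0^\perp$ be its orthogonal complement in $Z$, define $\Psi:E\times E_0^\perp\to\mathbb{R}$ by $\Psi(\xi,\eta):=\Phi(\xi+\eta)$, and denote by $D_2\Psi(\xi,\eta)$ the partial derivative of $\Psi$ with respect to $\eta$. Assume in addition: (i) $\Psi(\xi,\eta)$ is continuously differentiable with respect to $\eta$. (ii) There are constants $0<C<\infty$, $\gamma\ge 0$ and a function $u:E\to[0,\infty)$ satisfying $\int_E u(\xi)\,e^{-c\|\xi\|^2/4}\,d\mathcal{H}^N(\xi)<\infty$ (with $c$ the constant above) such that $$\|D_2\Psi(\xi,\eta)\|\le C\big(1+u(\xi)+\|\eta\|^\gamma\big)\qquad\text{for all }\xi\in E,\ \eta\in E_0^\perp .$$ Then $\mu$ is strongly transversal and its diagonal concentration $\mu_\infty$ is given by $$\int_{Z\times Z} f(y,z)\,d\mu_\infty(y,z)=\int_E f(\xi,\xi)\,e^{-\Phi(\xi)}\,d\mathcal{H}^N(\xi)$$ for every bounded continuous $f:Z\times Z\to\mathbb{R}$.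 Further, there is $C_1>0$ such that, for all $\beta$ sufficiently large, $$\|\mu_\beta-\mu_\infty\|_{\rm FN}\le C_1\,\beta^{-1/2}.$$
   Context: $Z$ is a finite-dimensional real space of dimension $2N$, equipped with a scalar product and the corresponding norm $\|\cdot\|$, and identified with $\mathbb{R}^{2N}$; $\mathcal{L}^{2N}$ is the Lebesgue measure on $Z$, $\mathcal{H}^N$ is the $N$-dimensional Hausdorff measure, and $\mathcal{H}^N\llcorner E$ is its restriction to $E$. $\mathcal{M}^+(Z\times Z)$ denotes the nonnegative Radon measures on $Z\times Z$, $\mathcal{M}_b(Z\times Z)$ the real-valued Radon measures of finite total variation, and $\mathcal{M}_b^+(Z\times Z)$ the nonnegative ones among the latter. Thermalization: for $\mu\in\mathcal{M}^+(Z\times Z)$ and $\beta>0$, $\mu_\beta:=w_\beta\,\mu$ with $w_\beta(y,z):=B_\beta^{-1}e^{-\beta\|y-z\|^2}$ and $B_\beta:=\int_Z e^{-\beta\|\xi\|^2}\,d\mathcal{L}^{2N}(\xi)$. Narrow convergence $\mu_k\rightharpoonup\mu$ in $\mathcal{M}_b(Z\times Z)$ means $\int f\,d\mu_k\to\int f\,d\mu$ for all bounded continuous $f:Z\times Z\to\mathbb{R}$. $\mu\in\mathcal{M}^+(Z\times Z)$ is strongly transversal, with (strong) diagonal concentration $\mu_\infty\in\mathcal{M}_b^+(Z\times Z)$, if $\mu_\beta\in\mathcal{M}_b^+(Z\times Z)$ for all $\beta$ sufficiently large and $\mu_\beta\rightharpoonup\mu_\infty$ narrowly as $\beta\to\infty$.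 Flat norm: for a fixed constant $\ell>0$ (depending only on the dimension), set $\|f\|_{\rm BL}:=\max\{\|f\|_\infty,\ \ell\,{\rm Lip}(f)\}$ for bounded Lipschitz functions $f$ on $Z\times Z$ (with the Euclidean product norm), and $\|\nu\|_{\rm FN}:=\sup\{\int_{Z\times Z} f\,d\nu:\ \|f\|_{\rm BL}\le 1\}$ for $\nu\in\mathcal{M}_b(Z\times Z)$. *)

theory Defs
  imports "HOL-Analysis.Analysis"
begin

text \<open>
  Normalised by the volume of the unit ball, so that the n-dimensional Hausdorff measure agrees with
  Lebesgue measure on n-dimensional Euclidean space. The empty set is treated separately since
  \<open>0 ^ 0 = 1\<close> (relevant only for \<open>n = 0\<close>); covering sets are required to be bounded since
  \<^const>\<open>diameter\<close> is meaningless on unbounded sets.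
\<close>

definition hausdorff_premeasure :: "nat \<Rightarrow> real \<Rightarrow> 'a::metric_space set \<Rightarrow> ennreal" where
  "hausdorff_premeasure n \<delta> A =
    (INF C \<in> {C :: nat \<Rightarrow> 'a set. A \<subseteq> (\<Union>i. C i) \<and> (\<forall>i. bounded (C i) \<and> diameter (C i) \<le> \<delta>)}.
      \<Sum>i. if C i = {} then 0
          else ennreal (unit_ball_vol (real n) * (diameter (C i) / 2) ^ n))"

definition hausdorff_outer_measure :: "nat \<Rightarrow> 'a::metric_space set \<Rightarrow> ennreal" where
  "hausdorff_outer_measure n A = (SUP \<delta>\<in>{0<..}. hausdorff_premeasure n \<delta> A)"

text \<open>
  The outer measure is a metric outer measure, hence countably additive on the Borel sets by
  Caratheodory's criterion, so that \<^const>\<open>measure_of\<close> does not collapse to the zero measure here.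
\<close>

definition hausdorff_measure :: "nat \<Rightarrow> 'a::metric_space measure" where
  "hausdorff_measure n = measure_of UNIV (sets borel) (hausdorff_outer_measure n)"

definition measure_restriction :: "'a measure \<Rightarrow> 'a set \<Rightarrow> 'a measure" where
  "measure_restriction M E = density M (indicator E)"

text \<open>
  On a Euclidean space every Borel measure that is finite on compact sets is automatically regular.
\<close>

definition radon_measure :: "'a::euclidean_space measure \<Rightarrow> bool" where
  "radon_measure M \<longleftrightarrow> sets M = sets borel \<and> (\<forall>K. compact K \<longrightarrow> emeasure M K < \<infinity>)"

definition finite_radon_measure :: "'a::euclidean_space measure \<Rightarrow> bool" where
  "finite_radon_measure M \<longleftrightarrow> radon_measure M \<and> finite_measure M"

definition bounded_continuous :: "('a::topological_space \<Rightarrow> real) \<Rightarrow> bool" where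
  "bounded_continuous f \<longleftrightarrow> continuous_on UNIV f \<and> bounded (range f)"

definition narrow_convergence ::
    "('i \<Rightarrow> 'a::euclidean_space measure) \<Rightarrow> 'a measure \<Rightarrow> 'i filter \<Rightarrow> bool" where
  "narrow_convergence \<mu> \<nu> F \<longleftrightarrow>
    (\<forall>f. bounded_continuous f \<longrightarrow>
      ((\<lambda>i. integral\<^sup>L (\<mu> i) f) \<longlongrightarrow> integral\<^sup>L \<nu> f) F)"

definition thermal_normalization :: "'a::euclidean_space itself \<Rightarrow> real \<Rightarrow> real" where
  "thermal_normalization _ \<beta> = (LINT \<xi>::'a|lborel. exp (- \<beta> * (norm \<xi>)\<^sup>2))"

definition thermal_weight :: "real \<Rightarrow> 'a::euclidean_space \<Rightarrow> 'a \<Rightarrow> real" where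
  "thermal_weight \<beta> y z =
    inverse (thermal_normalization TYPE('a) \<beta>) * exp (- \<beta> * (norm (y - z))\<^sup>2)"

definition thermalization ::
    "real \<Rightarrow> ('a::euclidean_space \<times> 'a) measure \<Rightarrow> ('a \<times> 'a) measure" where
  "thermalization \<beta> \<mu> = density \<mu> (\<lambda>(y, z). ennreal (thermal_weight \<beta> y z))"

text \<open>The second argument is the diagonal concentration, which is unique as a narrow limit.\<close>

definition strongly_transversal ::
    "('a::euclidean_space \<times> 'a) measure \<Rightarrow> ('a \<times> 'a) measure \<Rightarrow> bool" where
  "strongly_transversal \<mu> \<nu> \<longleftrightarrow>
    radon_measure \<mu> \<and> finite_radon_measure \<nu> \<and>
    (\<forall>\<^sub>F \<beta> in at_top. finite_radon_measure (thermalization \<beta> \<mu>)) \<and>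
    narrow_convergence (\<lambda>\<beta>. thermalization \<beta> \<mu>) \<nu> at_top"

definition bounded_lipschitz :: "('a::metric_space \<Rightarrow> real) \<Rightarrow> bool" where
  "bounded_lipschitz f \<longleftrightarrow> bounded (range f) \<and> (\<exists>L. lipschitz_on L UNIV f)"

definition sup_norm :: "('a \<Rightarrow> real) \<Rightarrow> real" where
  "sup_norm f = (SUP x. \<bar>f x\<bar>)"

definition lipschitz_constant :: "('a::metric_space \<Rightarrow> real) \<Rightarrow> real" where
  "lipschitz_constant f = Inf {L. lipschitz_on L UNIV f}"

definition BL_norm :: "real \<Rightarrow> ('a::metric_space \<Rightarrow> real) \<Rightarrow> real" where
  "BL_norm l f = max (sup_norm f) (l * lipschitz_constant f)"

text \<open>
  The flat norm of the signed measure \<open>\<mu> - \<nu>\<close>, for finite nonnegative \<open>\<mu>\<close> and \<open>\<nu>\<close>; every element of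
  the space of finite real-valued measures is of this form. The supremum is taken in
  \<^typ>\<open>ereal\<close>, so that an upper bound is meaningful without a separate boundedness proof.
\<close>

definition flat_norm_diff ::
    "real \<Rightarrow> 'a::euclidean_space measure \<Rightarrow> 'a measure \<Rightarrow> ereal" where
  "flat_norm_diff l \<mu> \<nu> =
    (SUP f \<in> {f. bounded_lipschitz f \<and> BL_norm l f \<le> 1}.
      ereal (integral\<^sup>L \<mu> f - integral\<^sup>L \<nu> f))"

text \<open>Unlike \<^term>\<open>0 powr 0 = (0::real)\<close>, this uses the convention that the value at exponent 0 is 1.\<close>

definition real_power :: "real \<Rightarrow> real \<Rightarrow> real" where
  "real_power x \<gamma> = (if \<gamma> = 0 then 1 else x powr \<gamma>)"

end

theory Submission
  imports Defs "HOL-Probability.Distributions"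
begin

text \<open>
  Every point \<open>y\<close> has an orthogonal projection \<open>\<xi>\<close> onto \<open>E\<close>, and for \<open>z \<in> E\<close> the vector \<open>y - z\<close> splits into
  the part \<open>y - \<xi>\<close> orthogonal to \<open>E\<close> and the part \<open>\<xi> - z\<close> along \<open>E\<close>. In the coordinates \<open>\<xi>\<close> and
  \<open>w = (y - z) / \<epsilon>\<close>, where \<open>\<epsilon> = \<beta> powr (- 1 / 2)\<close>, the thermal weight is the fixed Gaussian
  \<open>exp (- (norm w)\<^sup>2)\<close>, and \<open>y\<close> and \<open>z\<close> are \<open>\<xi>\<close> up to displacements of size \<open>\<epsilon> * norm w\<close>. Hence
  \<open>\<integral> f \<partial>\<mu>\<^sub>\<beta>\<close> is the integral of
  \<open>f (\<xi> + \<epsilon> (w - P w), \<xi> - \<epsilon> P w) * exp (- \<Phi> (\<xi> + \<epsilon> (w - P w)))\<close> against the product of the Hausdorff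
  measure on \<open>E\<close> and a Gaussian probability measure, where \<open>P\<close> is the orthogonal projection onto the
  direction space (lemmas \<open>change_of_variables\<close> and \<open>thermalization_gibbs\<close>). Formally setting \<open>\<epsilon> = 0\<close>
  gives \<open>\<integral> f (\<xi>, \<xi>) exp (- \<Phi> \<xi>)\<close>, which is the asserted limit.
  
  The change of variables is obtained by translating \<open>y\<close> for fixed \<open>z\<close> and then \<open>z\<close> along \<open>E\<close> for fixed
  \<open>y - z\<close>. It therefore rests only on the invariance of the measure on \<open>E\<close> under translations along \<open>E\<close>,
  together with finiteness on bounded sets, which makes Tonelli's theorem applicable. Both properties
  are derived from the definition of the Hausdorff measure, the second one by covering with grids.
  
  Coercivity with \<open>z = \<xi>\<close> gives \<open>exp (- \<Phi> (\<xi> + \<eta>)) \<le> exp (b - c * (norm \<xi>)\<^sup>2 + \<beta>\<^sub>0 * (norm \<eta>)\<^sup>2)\<close>, so for small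
  \<open>\<epsilon>\<close> the integrands have a common integrable Gaussian majorant. For the rate, the mean value theorem in
  the direction orthogonal to \<open>E\<close> and the growth bound on the gradient show that replacing
  \<open>\<xi> + \<epsilon> (w - P w)\<close> by \<open>\<xi>\<close> in \<open>exp (- \<Phi>)\<close> costs \<open>\<epsilon>\<close> times an integrable function (lemma
  \<open>weight_diff\<close>); a Lipschitz test function adds another error of order \<open>\<epsilon>\<close> (lemma
  \<open>rescaled_lipschitz_estimate\<close>). The same mean value estimate gives the pointwise convergence that
  dominated convergence needs for general bounded continuous test functions (lemma
  \<open>narrow_convergence_rescaled\<close>).
\<close>

section \<open>Translation invariance and local finiteness of the Hausdorff measure\<close>

lemma diameter_translation_image:
  fixes S :: "'a::real_normed_vector set"
  shows "diameter ((+) a ` S) = diameter S"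
proof -
  have "(\<lambda>(x, y). dist x y) ` ((+) a ` S \<times> (+) a ` S) = (\<lambda>(x, y). dist x y) ` (S \<times> S)"
    by (force simp: image_iff)
  then show ?thesis by (simp add: diameter_def)
qed

lemma hausdorff_premeasure_translation_le:
  fixes A :: "'a::real_normed_vector set"
  shows "hausdorff_premeasure n \<delta> ((+) a ` A) \<le> hausdorff_premeasure n \<delta> A"
  unfolding hausdorff_premeasure_def
proof (rule INF_mono)
  fix D assume D: "D \<in> {C. A \<subseteq> (\<Union>i::nat. C i) \<and> (\<forall>i. bounded (C i) \<and> diameter (C i) \<le> \<delta>)}"
  show "\<exists>C\<in>{C. (+) a ` A \<subseteq> (\<Union>i::nat. C i) \<and> (\<forall>i. bounded (C i) \<and> diameter (C i) \<le> \<delta>)}.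
     (\<Sum>i. if C i = {} then 0 else ennreal (unit_ball_vol (real n) * (diameter (C i) / 2) ^ n))
     \<le> (\<Sum>i. if D i = {} then 0 else ennreal (unit_ball_vol (real n) * (diameter (D i) / 2) ^ n))"
  proof (rule bexI)
    have "(+) a ` A \<subseteq> (+) a ` (\<Union>i. D i)" using D by blast
    then show "(\<lambda>i. (+) a ` D i) \<in>
        {C. (+) a ` A \<subseteq> (\<Union>i. C i) \<and> (\<forall>i. bounded (C i) \<and> diameter (C i) \<le> \<delta>)}"
      using D by (simp add: image_UN diameter_translation_image bounded_translation)
  qed (simp add: diameter_translation_image cong: if_cong)
qed

lemma hausdorff_outer_measure_translation:
  fixes A :: "'a::real_normed_vector set"
  shows "hausdorff_outer_measure n ((+) a ` A) = hausdorff_outer_measure n A"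
proof -
  have le: "hausdorff_outer_measure n ((+) a ` A) \<le> hausdorff_outer_measure n A"
    for a and A :: "'a set"
    unfolding hausdorff_outer_measure_def
    by (intro SUP_mono) (meson hausdorff_premeasure_translation_le)
  have "A = (+) (- a) ` (+) a ` A" by (simp add: image_image)
  then have "hausdorff_outer_measure n A \<le> hausdorff_outer_measure n ((+) a ` A)"
    by (metis le)
  with le show ?thesis by (meson antisym)
qed

lemma hausdorff_outer_measure_mono:
  "A \<subseteq> B \<Longrightarrow> hausdorff_outer_measure n A \<le> hausdorff_outer_measure n B"
  unfolding hausdorff_outer_measure_def hausdorff_premeasure_def
  by (intro SUP_mono' INF_superset_mono) auto

lemma hausdorff_premeasure_finite_cover:
  fixes Q :: "'i \<Rightarrow> 'a::metric_space set"
  assumes "finite I" and cover: "A \<subseteq> (\<Union>i\<in>I. Q i)" and "0 \<le> d" "d \<le> \<delta>"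
    and Q: "\<And>i. i \<in> I \<Longrightarrow> bounded (Q i) \<and> diameter (Q i) \<le> d"
  shows "hausdorff_premeasure n \<delta> A \<le> ennreal (real (card I) * (unit_ball_vol (real n) * (d / 2) ^ n))"
proof -
  obtain h where h: "bij_betw h {0..<card I} I"
    using ex_bij_betw_nat_finite[OF \<open>finite I\<close>] by blast
  define C where "C j = (if j < card I then Q (h j) else {})" for j
  have hI: "h j \<in> I" if "j < card I" for j
    using h that by (auto simp: bij_betw_def)
  have "A \<subseteq> (\<Union>j. C j)"
  proof
    fix x assume "x \<in> A"
    then obtain i where "i \<in> I" "x \<in> Q i" using cover by auto
    moreover from \<open>i \<in> I\<close> h obtain j where "j < card I" "h j = i"
      by (auto simp: bij_betw_def image_iff) (metis atLeastLessThan_iff image_iff)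
    ultimately have "x \<in> C j" by (auto simp: C_def)
    then show "x \<in> (\<Union>j. C j)" by blast
  qed
  moreover have "bounded (C j) \<and> diameter (C j) \<le> \<delta>" for j
    using Q[OF hI, of j] assms(3,4) by (auto simp: C_def)
  ultimately have "hausdorff_premeasure n \<delta> A \<le>
      (\<Sum>j. if C j = {} then 0 else ennreal (unit_ball_vol (real n) * (diameter (C j) / 2) ^ n))"
    unfolding hausdorff_premeasure_def by (intro INF_lower) auto
  also have "\<dots> = (\<Sum>j<card I. if C j = {} then 0 else ennreal (unit_ball_vol (real n) * (diameter (C j) / 2) ^ n))"
    by (intro suminf_finite) (auto simp: C_def)
  also have "\<dots> \<le> (\<Sum>j<card I. ennreal (unit_ball_vol (real n) * (d / 2) ^ n))"
  proof (intro sum_mono)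
    fix j assume "j \<in> {..<card I}"
    then have *: "bounded (C j)" "diameter (C j) \<le> d" using Q[OF hI, of j] by (auto simp: C_def)
    have "unit_ball_vol (real n) * (diameter (C j) / 2) ^ n \<le> unit_ball_vol (real n) * (d / 2) ^ n"
      using * by (intro mult_left_mono power_mono) (auto simp: diameter_ge_0)
    then show "(if C j = {} then 0 else ennreal (unit_ball_vol (real n) * (diameter (C j) / 2) ^ n))
        \<le> ennreal (unit_ball_vol (real n) * (d / 2) ^ n)"
      by (auto intro: ennreal_leI)
  qed
  also have "\<dots> = ennreal (real (card I) * (unit_ball_vol (real n) * (d / 2) ^ n))"
    using \<open>0 \<le> d\<close> by (simp add: ennreal_mult ennreal_of_nat_eq_real_of_nat)
  finally show ?thesis .
qed

text \<open>
  Cut the cube with side \<open>2 R\<close> around the origin, in orthonormal coordinates of the subspace, into a grid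
  of mesh \<open>2 R / m\<close>. The number of cells grows like \<open>m ^ n\<close> and the \<open>n\<close>-th power of their diameter
  shrinks like \<open>m ^ (- n)\<close>, so the covering sum stays bounded as the mesh tends to \<open>0\<close>.
\<close>

lemma hausdorff_outer_measure_subspace_finite:
  fixes S :: "'a::euclidean_space set"
  assumes "subspace S" and R: "0 < R"
  shows "hausdorff_outer_measure (dim S) (S \<inter> cball 0 R) < \<infinity>"
proof -
  define n where "n = dim S"
  obtain B where B: "B \<subseteq> S" "pairwise orthogonal B" "\<And>x. x \<in> B \<Longrightarrow> norm x = 1"
      "independent B" "card B = n" "span B = S"
    using orthonormal_basis_subspace[OF \<open>subspace S\<close>] unfolding n_def by metis
  have finB: "finite B" using \<open>independent B\<close> by (rule independent_imp_finite)
  have inner_B: "a \<bullet> b = (if a = b then 1 else 0)" if "a \<in> B" "b \<in> B" for a b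
    using B(2,3) that by (auto simp: pairwise_def orthogonal_def norm_eq_1)
  have expand: "x = (\<Sum>b\<in>B. (x \<bullet> b) *\<^sub>R b)" if x: "x \<in> S" for x
  proof -
    from x B(6) finB obtain r where r: "x = (\<Sum>b\<in>B. r b *\<^sub>R b)"
      by (auto simp: span_finite)
    have "x \<bullet> b = r b" if "b \<in> B" for b
      using that finB by (simp add: r inner_sum_left inner_B if_distrib cong: if_cong)
    then show ?thesis by (subst r) (auto intro!: sum.cong)
  qed
  have bound: "hausdorff_premeasure n \<delta> (S \<inter> cball 0 R)
      \<le> ennreal (unit_ball_vol (real n) * (2 * real n * R) ^ n)" if "0 < \<delta>" for \<delta>
  proof -
    obtain m :: nat where m: "2 * real n * R / \<delta> < real m" "0 < m"
      by (metis reals_Archimedean2 gr0I less_le_trans linorder_not_le max.strict_coboundedI1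
          of_nat_0_le_iff order.strict_trans1 of_nat_less_iff max_less_iff_conj zero_less_one of_nat_1)
    define h where "h = 2 * R / real m"
    have h: "0 < h" using R m by (simp add: h_def)
    define Q where "Q k = {x \<in> S. \<forall>b\<in>B. real (k b) * h \<le> x \<bullet> b + R \<and> x \<bullet> b + R \<le> (real (k b) + 1) * h}"
      for k :: "'a \<Rightarrow> nat"
    \<comment> \<open>with \<open>m + 1\<close> indices per axis, points on the upper face of the cube need no separate treatment\<close>
    define I where "I = PiE B (\<lambda>_. {..m})"
    have card_I: "card I = (m + 1) ^ n" using finB B(5) by (simp add: I_def card_PiE)
    have d: "real n * h \<le> \<delta>" using m \<open>0 < \<delta>\<close> by (simp add: h_def field_simps)
    have dist_Q: "norm (x - y) \<le> real n * h" if xy: "x \<in> Q k" "y \<in> Q k" for x y k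
    proof -
      have "x - y \<in> S" using xy \<open>subspace S\<close> by (auto simp: Q_def subspace_diff)
      have "norm (x - y) \<le> (\<Sum>b\<in>B. norm (((x - y) \<bullet> b) *\<^sub>R b))"
        by (subst expand[OF \<open>x - y \<in> S\<close>]) (rule norm_sum)
      also have "\<dots> \<le> (\<Sum>b\<in>B. h)"
      proof (intro sum_mono)
        fix b assume b: "b \<in> B"
        then have "\<bar>(x - y) \<bullet> b\<bar> \<le> h" using xy
          by (force simp: Q_def inner_diff_left algebra_simps abs_le_iff)
        then show "norm (((x - y) \<bullet> b) *\<^sub>R b) \<le> h" using B(3)[OF b] by simp
      qed
      finally show ?thesis using B(5) by simp
    qed
    have cover: "S \<inter> cball 0 R \<subseteq> (\<Union>k\<in>I. Q k)"
    proof
      fix x assume x: "x \<in> S \<inter> cball 0 R"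
      define k where "k = (\<lambda>b\<in>B. nat \<lfloor>(x \<bullet> b + R) / h\<rfloor>)"
      have xb: "0 \<le> x \<bullet> b + R" "x \<bullet> b + R \<le> 2 * R" if "b \<in> B" for b
      proof -
        have "\<bar>x \<bullet> b\<bar> \<le> norm x * norm b" by (rule Cauchy_Schwarz_ineq2)
        also have "\<dots> \<le> R" using x B(3)[OF that] by simp
        finally show "0 \<le> x \<bullet> b + R" "x \<bullet> b + R \<le> 2 * R" by auto
      qed
      have "k b \<le> m" if "b \<in> B" for b
      proof -
        have "(x \<bullet> b + R) / h \<le> real m" using xb[OF that] h m by (simp add: h_def field_simps)
        then have "\<lfloor>(x \<bullet> b + R) / h\<rfloor> \<le> int m" by linarith
        then show ?thesis using that by (simp add: k_def)
      qed
      then have "k \<in> I" by (auto simp: I_def k_def)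
      moreover have "x \<in> Q k"
      proof -
        have "real (k b) * h \<le> x \<bullet> b + R \<and> x \<bullet> b + R \<le> (real (k b) + 1) * h" if "b \<in> B" for b
        proof -
          obtain q where q: "x \<bullet> b + R = q * h" using h by (metis nonzero_divide_eq_eq less_irrefl)
          then have "0 \<le> q" "(x \<bullet> b + R) / h = q"
            using xb(1)[OF that] h by (auto simp: zero_le_mult_iff)
          then have "real (k b) \<le> q" "q \<le> real (k b) + 1" using that by (simp_all add: k_def)
          then show ?thesis using h by (simp add: q mult_right_mono)
        qed
        then show ?thesis using x by (simp add: Q_def)
      qed
      ultimately show "x \<in> (\<Union>k\<in>I. Q k)" by blast
    qed
    have "hausdorff_premeasure n \<delta> (S \<inter> cball 0 R)
        \<le> ennreal (real (card I) * (unit_ball_vol (real n) * (real n * h / 2) ^ n))"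
    proof (rule hausdorff_premeasure_finite_cover[OF _ cover _ d])
      show "finite I" using finB by (auto simp: I_def intro: finite_PiE)
      show "0 \<le> real n * h" using h by simp
      fix k
      have "bounded (Q k)"
      proof (cases "Q k = {}")
        case False
        then obtain y where "y \<in> Q k" by blast
        then show ?thesis using dist_Q unfolding bounded_def dist_norm by blast
      qed simp
      moreover have "diameter (Q k) \<le> real n * h"
        using dist_Q h by (intro diameter_le) auto
      ultimately show "bounded (Q k) \<and> diameter (Q k) \<le> real n * h" ..
    qed
    also have "\<dots> \<le> ennreal (unit_ball_vol (real n) * (2 * real n * R) ^ n)"
    proof (rule ennreal_leI)
      have "(real m + 1) * (real n * h / 2) \<le> (2 * real m) * (real n * h / 2)"
        using m h by (intro mult_right_mono) auto
      also have "\<dots> = 2 * real n * R" using m by (simp add: h_def)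
      finally have "(real m + 1) * (real n * h / 2) \<le> 2 * real n * R" .
      then have "((real m + 1) * (real n * h / 2)) ^ n \<le> (2 * real n * R) ^ n"
        using h by (intro power_mono) auto
      then have "unit_ball_vol (real n) * ((real m + 1) * (real n * h / 2)) ^ n
          \<le> unit_ball_vol (real n) * (2 * real n * R) ^ n"
        by (intro mult_left_mono) auto
      then show "real (card I) * (unit_ball_vol (real n) * (real n * h / 2) ^ n)
          \<le> unit_ball_vol (real n) * (2 * real n * R) ^ n"
        by (simp only: card_I power_mult_distrib of_nat_power of_nat_add of_nat_1 mult.assoc
            mult.left_commute[of "unit_ball_vol (real n)"])
    qed
    finally show ?thesis .
  qed
  have "hausdorff_outer_measure n (S \<inter> cball 0 R)
      \<le> ennreal (unit_ball_vol (real n) * (2 * real n * R) ^ n)"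
    unfolding hausdorff_outer_measure_def by (intro SUP_least) (use bound in auto)
  also have "\<dots> < \<infinity>" by simp
  finally show ?thesis by (simp add: n_def)
qed

lemma sets_hausdorff_measure [simp]: "sets (hausdorff_measure n) = sets borel"
  and space_hausdorff_measure [simp]: "space (hausdorff_measure n) = UNIV"
  unfolding hausdorff_measure_def
  by (auto simp: sets.sigma_sets_eq[of borel, simplified])

text \<open>
  \<^const>\<open>measure_of\<close> returns the given set function if it is countably additive, and the zero measure
  otherwise. Translation invariance and local finiteness pass from the outer measure to the measure in
  either case.
\<close>

lemma emeasure_hausdorff_measure_cases:
  fixes n :: nat
  shows "(\<forall>A::'a::metric_space set\<in>sets borel. emeasure (hausdorff_measure n) A = hausdorff_outer_measure n A) \<or>
   (\<forall>A::'a set\<in>sets borel. emeasure (hausdorff_measure n) A = 0)"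
  unfolding hausdorff_measure_def emeasure_measure_of_conv
  by (cases "measure_space UNIV (sets borel) (hausdorff_outer_measure n :: 'a set \<Rightarrow> ennreal)")
    (auto simp: sets.sigma_sets_eq[of borel, simplified])

lemma emeasure_hausdorff_measure_translation:
  fixes A :: "'a::euclidean_space set"
  assumes "A \<in> sets borel"
  shows "emeasure (hausdorff_measure n) ((+) a ` A) = emeasure (hausdorff_measure n) A"
proof -
  have "(+) a ` A = (\<lambda>x. - a + x) -` A"
    by (force simp: image_iff algebra_simps)
  moreover have "(\<lambda>x. - a + x) -` A \<in> sets borel"
    using assms by (intro measurable_sets_borel[where M=borel]) auto
  ultimately have "(+) a ` A \<in> sets borel" by simp
  then show ?thesis
    using assms emeasure_hausdorff_measure_cases[of n, where ?'a = 'a]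
    by (metis hausdorff_outer_measure_translation)
qed

lemma emeasure_hausdorff_measure_affine_finite:
  fixes E :: "'a::euclidean_space set"
  assumes "affine E" "aff_dim E = int n" "bounded A" "A \<subseteq> E" "A \<in> sets borel"
  shows "emeasure (hausdorff_measure n) A < \<infinity>"
proof (cases "E = {}")
  case True
  then show ?thesis using assms by simp
next
  case False
  obtain S where S: "subspace S" "affine_parallel E S"
    using affine_parallel_subspace[OF assms(1) False] by blast
  then obtain a where a: "S = (\<lambda>x. a + x) ` E" by (auto simp: affine_parallel_def)
  have dim: "dim S = n"
    using aff_dim_parallel_subspace[OF False S(1)] S(2) assms(1,2)
    by (simp add: affine_hull_eq[THEN iffD2])
  obtain R where R: "0 < R" "\<forall>x\<in>(+) a ` A. norm x \<le> R"
    using bounded_translation[OF assms(3), of a] by (auto simp: bounded_pos)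
  have "hausdorff_outer_measure n A = hausdorff_outer_measure n ((+) a ` A)"
    by (simp add: hausdorff_outer_measure_translation)
  also have "\<dots> \<le> hausdorff_outer_measure n (S \<inter> cball 0 R)"
    using R assms(4) by (intro hausdorff_outer_measure_mono) (auto simp: a)
  also have "\<dots> < \<infinity>"
    using hausdorff_outer_measure_subspace_finite[OF S(1) R(1)] dim by simp
  finally show ?thesis
    using emeasure_hausdorff_measure_cases[of n, where ?'a = 'a] assms(5) by force
qed

section \<open>Gaussian integrals\<close>

lemma integrable_gaussian:
  assumes a: "0 < a"
  shows "integrable lborel (\<lambda>w::'a::euclidean_space. exp (- a * (norm w)\<^sup>2))"
proof (rule integrableI_bounded)
  define \<sigma> where "\<sigma> = 1 / sqrt (2 * a)"
  have \<sigma>: "0 < \<sigma>" "2 * \<sigma>\<^sup>2 = 1 / a" using a by (simp_all add: \<sigma>_def power_divide)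
  have eq: "exp (- a * x\<^sup>2) = sqrt (2 * pi * \<sigma>\<^sup>2) * normal_density 0 \<sigma> x" for x
    using \<sigma> a by (simp add: normal_density_def)
  have "integrable lborel (normal_density 0 \<sigma>)" using \<sigma> by simp
  then have one: "(\<integral>\<^sup>+x. ennreal (exp (- a * x\<^sup>2)) \<partial>lborel) < \<infinity>"
    unfolding eq by (subst nn_integral_eq_integral) auto
  have norm_eq: "(norm w)\<^sup>2 = (\<Sum>i\<in>Basis. (w \<bullet> i)\<^sup>2)" for w :: 'a
    by (subst power2_norm_eq_inner, subst euclidean_inner) (simp add: power2_eq_square)
  have exp_eq: "exp (- a * (norm w)\<^sup>2) = (\<Prod>i\<in>Basis. exp (- a * (w \<bullet> i)\<^sup>2))" for w :: 'a
    unfolding norm_eq sum_distrib_left by (rule exp_sum) simp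
  have "(\<integral>\<^sup>+w. ennreal (norm (exp (- a * (norm w)\<^sup>2))) \<partial>(lborel :: 'a measure))
      = (\<integral>\<^sup>+w. (\<Prod>i\<in>Basis. ennreal (exp (- a * (w \<bullet> i)\<^sup>2))) \<partial>(lborel :: 'a measure))"
    unfolding exp_eq by (simp add: prod_ennreal abs_prod)
  also have "\<dots> = (\<Prod>i\<in>(Basis::'a set). \<integral>\<^sup>+x. ennreal (exp (- a * x\<^sup>2)) \<partial>lborel)"
    by (rule nn_integral_lborel_prod) auto
  also have "\<dots> < \<infinity>" using one by (simp add: power_less_top_ennreal)
  finally show "(\<integral>\<^sup>+w. ennreal (norm (exp (- a * (norm w)\<^sup>2))) \<partial>(lborel :: 'a measure)) < \<infinity>" .
qed measurable

lemma nn_integral_lborel_scale: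
  fixes f :: "'a::euclidean_space \<Rightarrow> ennreal"
  assumes [measurable]: "f \<in> borel_measurable borel" and "0 < \<epsilon>"
  shows "(\<integral>\<^sup>+v. f v \<partial>lborel) = ennreal (\<epsilon> ^ DIM('a)) * (\<integral>\<^sup>+w. f (\<epsilon> *\<^sub>R w) \<partial>lborel)"
  by (subst lborel_affine[of \<epsilon> 0])
    (use \<open>0 < \<epsilon>\<close> in \<open>auto simp: nn_integral_density nn_integral_distr nn_integral_cmult\<close>)

lemma thermal_normalization_scale:
  assumes "0 < \<beta>"
  shows "thermal_normalization TYPE('a::euclidean_space) \<beta>
    = (\<beta> powr (- 1 / 2)) ^ DIM('a) * thermal_normalization TYPE('a) 1"
proof -
  define \<epsilon> where "\<epsilon> = \<beta> powr (- 1 / 2)"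
  have \<epsilon>: "0 < \<epsilon>" "\<beta> * \<epsilon>\<^sup>2 = 1"
    using assms by (simp_all add: \<epsilon>_def powr_minus powr_half_sqrt power_inverse)
  have "(LINT v::'a|lborel. exp (- \<beta> * (norm v)\<^sup>2))
      = \<epsilon> ^ DIM('a) * (LINT w::'a|lborel. exp (- \<beta> * (norm (\<epsilon> *\<^sub>R w))\<^sup>2))"
    by (subst lborel_affine[of \<epsilon> 0]) (use \<epsilon> in \<open>auto simp: integral_density integral_distr\<close>)
  also have "(LINT w::'a|lborel. exp (- \<beta> * (norm (\<epsilon> *\<^sub>R w))\<^sup>2)) = (LINT w::'a|lborel. exp (- 1 * (norm w)\<^sup>2))"
    using \<epsilon> by (simp add: power_mult_distrib mult.assoc[symmetric])
  finally show ?thesis by (simp add: thermal_normalization_def \<epsilon>_def)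
qed

lemma thermal_normalization_pos:
  assumes "0 < \<beta>"
  shows "0 < thermal_normalization TYPE('a::euclidean_space) \<beta>"
proof -
  have "0 \<le> thermal_normalization TYPE('a) \<beta>" by (simp add: thermal_normalization_def)
  moreover have "thermal_normalization TYPE('a) \<beta> \<noteq> 0"
    unfolding thermal_normalization_def
    using integrable_gaussian[OF assms, where ?'a = 'a]
    by (subst integral_nonneg_eq_0_iff_AE) (use AE_iff_measurable[of UNIV "lborel :: 'a measure" "\<lambda>_. False"] in auto)
  ultimately show ?thesis by simp
qed

lemma (in pair_sigma_finite) integrable_product:
  fixes f :: "_ \<Rightarrow> real" and g :: "_ \<Rightarrow> real"
  assumes "integrable M1 f" "integrable M2 g"
  shows "integrable (M1 \<Otimes>\<^sub>M M2) (\<lambda>(x, y). f x * g y)"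
  using assms by (intro Fubini_integrable) (auto simp: abs_mult)

section \<open>A change of variables for measures invariant under a subspace\<close>

text \<open>
  The measure \<open>m\<close> abstracts the restriction of the Hausdorff measure to \<open>E\<close>, and \<open>P\<close> is the orthogonal
  projection onto the direction space \<open>E\<^sub>0\<close>. Invariance under translations in \<open>E\<^sub>0\<close> is what makes the
  change of variables below possible.
\<close>

locale parallel_invariant_measure =
  fixes E E\<^sub>0 :: "'a::euclidean_space set" and m :: "'a measure" and P :: "'a \<Rightarrow> 'a"
  assumes sets_m [measurable_cong]: "sets m = sets borel"
    and E_borel [measurable]: "E \<in> sets borel"
    and carried: "AE z in m. z \<in> E"
    and finite_on_bounded: "\<And>A. bounded A \<Longrightarrow> A \<in> sets borel \<Longrightarrow> emeasure m A < \<infinity>"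
    and invariant: "\<And>h. h \<in> E\<^sub>0 \<Longrightarrow> distr m borel ((+) h) = m"
    and E_nonempty: "E \<noteq> {}"
    and E_diff: "\<And>x y. x \<in> E \<Longrightarrow> y \<in> E \<Longrightarrow> x - y \<in> E\<^sub>0"
    and subspace: "subspace E\<^sub>0"
    and linear_P: "linear P"
    and P_mem: "\<And>v. P v \<in> E\<^sub>0"
    and P_orthogonal: "\<And>v. v - P v \<in> orthogonal_comp E\<^sub>0"
begin

lemma space_m [simp]: "space m = UNIV"
  using sets_eq_imp_space_eq[OF sets_m] by simp

sublocale sigma_finite_measure m
proof (standard, intro exI[of _ "range (\<lambda>n::nat. cball 0 (real n))"] conjI ballI)
  have "\<exists>n::nat. norm x \<le> real n" for x :: 'a by (rule real_arch_simple)
  then show "\<Union> (range (\<lambda>n::nat. cball 0 (real n))) = space m" by auto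
qed (use finite_on_bounded in \<open>auto simp: sets_m less_top\<close>)

sublocale m_lborel: pair_sigma_finite m lborel ..
sublocale lborel_m: pair_sigma_finite lborel m ..

lemma norm_split: "norm (P v) \<le> norm v" "norm (v - P v) \<le> norm v"
proof -
  have "P v \<bullet> (v - P v) = 0"
    using P_mem[of v] P_orthogonal[of v] by (auto simp: orthogonal_comp_def orthogonal_def)
  then have "(norm v)\<^sup>2 = (norm (P v))\<^sup>2 + (norm (v - P v))\<^sup>2"
    by (simp add: power2_norm_eq_inner inner_diff_left inner_diff_right inner_commute)
  then have "(norm (P v))\<^sup>2 \<le> (norm v)\<^sup>2" "(norm (v - P v))\<^sup>2 \<le> (norm v)\<^sup>2" by auto
  then show "norm (P v) \<le> norm v" "norm (v - P v) \<le> norm v"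
    by (auto intro: power2_le_imp_le)
qed

lemma P_measurable [measurable]: "P \<in> borel_measurable borel"
  by (intro borel_measurable_continuous_onI linear_continuous_on linear_conv_bounded_linear[THEN iffD1] linear_P)

text \<open>
  Three substitutions, one at a time: \<open>y = z + v\<close> for fixed \<open>z\<close>, by translation invariance of Lebesgue
  measure; \<open>z = \<xi> - P v\<close> for fixed \<open>v\<close>, by invariance of \<open>m\<close> under \<open>E\<^sub>0\<close>; and finally \<open>v = \<epsilon> w\<close>. They
  turn \<open>(y, z)\<close> into \<open>(\<xi> + (v - P v), \<xi> - P v)\<close>: the base point \<open>\<xi>\<close> differs from \<open>y\<close> by a vector
  orthogonal to \<open>E\<^sub>0\<close> and from \<open>z\<close> by a vector in \<open>E\<^sub>0\<close>, while \<open>y - z = v\<close>.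
\<close>

lemma change_of_variables:
  fixes F :: "'a \<times> 'a \<Rightarrow> ennreal"
  assumes F [measurable]: "F \<in> borel_measurable (borel \<Otimes>\<^sub>M borel)" and \<epsilon>: "0 < \<epsilon>"
  shows "(\<integral>\<^sup>+y. \<integral>\<^sup>+z. F (y, z) \<partial>m \<partial>lborel)
    = ennreal (\<epsilon> ^ DIM('a)) *
      (\<integral>\<^sup>+\<xi>. \<integral>\<^sup>+w. F (\<xi> + \<epsilon> *\<^sub>R (w - P w), \<xi> - \<epsilon> *\<^sub>R P w) \<partial>lborel \<partial>m)"
proof -
  have "(\<integral>\<^sup>+y. \<integral>\<^sup>+z. F (y, z) \<partial>m \<partial>lborel) = (\<integral>\<^sup>+z. \<integral>\<^sup>+y. F (y, z) \<partial>lborel \<partial>m)"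
    by (rule lborel_m.Fubini'[symmetric]) simp
  also have "\<dots> = (\<integral>\<^sup>+z. \<integral>\<^sup>+v. F (z + v, z) \<partial>lborel \<partial>m)"
  proof (rule nn_integral_cong)
    fix z
    have "(\<integral>\<^sup>+y. F (y, z) \<partial>lborel) = (\<integral>\<^sup>+y. F (y, z) \<partial>distr lborel borel ((+) z))"
      by (simp add: lborel_distr_plus)
    also have "\<dots> = (\<integral>\<^sup>+v. F (z + v, z) \<partial>lborel)" by (subst nn_integral_distr) auto
    finally show "(\<integral>\<^sup>+y. F (y, z) \<partial>lborel) = (\<integral>\<^sup>+v. F (z + v, z) \<partial>lborel)" .
  qed
  also have "\<dots> = (\<integral>\<^sup>+v. \<integral>\<^sup>+z. F (z + v, z) \<partial>m \<partial>lborel)"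
    by (rule m_lborel.Fubini'[symmetric]) simp
  also have "\<dots> = (\<integral>\<^sup>+v. \<integral>\<^sup>+\<xi>. F (\<xi> + (v - P v), \<xi> - P v) \<partial>m \<partial>lborel)"
  proof (rule nn_integral_cong)
    fix v
    have "- P v \<in> E\<^sub>0" using subspace P_mem by (rule subspace_neg)
    then have "(\<integral>\<^sup>+z. F (z + v, z) \<partial>m) = (\<integral>\<^sup>+z. F (z + v, z) \<partial>distr m borel ((+) (- P v)))"
      by (simp add: invariant)
    also have "\<dots> = (\<integral>\<^sup>+\<xi>. F (\<xi> + (v - P v), \<xi> - P v) \<partial>m)"
      by (subst nn_integral_distr) (auto simp: algebra_simps)
    finally show "(\<integral>\<^sup>+z. F (z + v, z) \<partial>m) = (\<integral>\<^sup>+\<xi>. F (\<xi> + (v - P v), \<xi> - P v) \<partial>m)" .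
  qed
  also have "\<dots> = ennreal (\<epsilon> ^ DIM('a)) *
      (\<integral>\<^sup>+w. \<integral>\<^sup>+\<xi>. F (\<xi> + \<epsilon> *\<^sub>R (w - P w), \<xi> - \<epsilon> *\<^sub>R P w) \<partial>m \<partial>lborel)"
    by (subst nn_integral_lborel_scale[OF _ \<epsilon>])
      (simp_all add: linear_cmul[OF linear_P] scaleR_diff_right)
  also have "(\<integral>\<^sup>+w. \<integral>\<^sup>+\<xi>. F (\<xi> + \<epsilon> *\<^sub>R (w - P w), \<xi> - \<epsilon> *\<^sub>R P w) \<partial>m \<partial>lborel)
      = (\<integral>\<^sup>+\<xi>. \<integral>\<^sup>+w. F (\<xi> + \<epsilon> *\<^sub>R (w - P w), \<xi> - \<epsilon> *\<^sub>R P w) \<partial>lborel \<partial>m)"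
    by (rule m_lborel.Fubini') simp
  finally show ?thesis .
qed

text \<open>
  A unit ball that meets \<open>E\<close> lies in a ball of radius 2 centred on \<open>E\<close>, and all of these are translates
  of each other along \<open>E\<^sub>0\<close>.
\<close>

lemma unit_balls_bounded_mass: "\<exists>K<\<infinity>. \<forall>y. emeasure m (cball y 1) \<le> K"
proof -
  obtain p where p: "p \<in> E" using E_nonempty by blast
  have "emeasure m (cball y 1) \<le> emeasure m (cball p 2)" for y
  proof (cases "cball y 1 \<inter> E = {}")
    case True
    have "AE z in m. z \<notin> cball y 1" by (rule AE_mp[OF carried AE_I2]) (use True in auto)
    then have "emeasure m (cball y 1) = 0"
      by (subst (asm) AE_iff_measurable[where N="cball y 1"]) (auto simp: sets_m)
    then show ?thesis by simp
  next
    case False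
    then obtain q where q: "q \<in> cball y 1" "q \<in> E" by blast
    have "emeasure m (cball y 1) = emeasure (distr m borel ((+) (q - p))) (cball y 1)"
      using invariant[OF E_diff[OF q(2) p]] by simp
    also have "\<dots> = emeasure m ((+) (q - p) -` cball y 1)"
      by (subst emeasure_distr) auto
    also have "\<dots> \<le> emeasure m (cball p 2)"
    proof (rule emeasure_mono)
      show "(+) (q - p) -` cball y 1 \<subseteq> cball p 2"
      proof
        fix x assume "x \<in> (+) (q - p) -` cball y 1"
        then have "norm (y - (q - p + x)) \<le> 1" "norm (y - q) \<le> 1"
          using q by (auto simp: dist_norm)
        moreover have "p - x = (y - (q - p + x)) - (y - q)" by simp
        then have "norm (p - x) \<le> norm (y - (q - p + x)) + norm (y - q)"
          by (metis norm_triangle_ineq4)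
        ultimately have "norm (p - x) \<le> 2" by linarith
        then show "x \<in> cball p 2" by (simp add: dist_norm)
      qed
    qed (simp add: sets_m)
    finally show ?thesis .
  qed
  then show ?thesis using finite_on_bounded[of "cball p 2"] by auto
qed

text \<open>
  Tonelli's theorem for the kernel \<open>exp (- (c / 2) * (norm y)\<^sup>2)\<close> on the set of pairs \<open>(y, z)\<close> at distance
  at most 1. Integrating over \<open>z\<close> first gives at most a multiple of the Gaussian integral over the whole
  space, since unit balls have uniformly bounded mass; integrating over \<open>y\<close> first gives at least a
  multiple of \<open>exp (- c * (norm z)\<^sup>2)\<close>, since \<open>(norm y)\<^sup>2 \<le> 2 * (norm z)\<^sup>2 + 2\<close>.
\<close>

lemma integrable_gaussian_m:
  assumes c: "0 < c"
  shows "integrable m (\<lambda>\<xi>. exp (- c * (norm \<xi>)\<^sup>2))"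
proof (rule integrableI_bounded)
  obtain K where K: "K < \<infinity>" "\<And>y. emeasure m (cball y 1) \<le> K"
    using unit_balls_bounded_mass by blast
  let ?V = "emeasure lborel (cball (0::'a) 1)"
  have V: "0 < ?V" "?V < \<infinity>"
    using unit_ball_vol_pos[of "real DIM('a)"] by (auto simp: emeasure_cball)
  have "ennreal (exp (- c)) * ?V * (\<integral>\<^sup>+z. ennreal (exp (- c * (norm z)\<^sup>2)) \<partial>m)
      = (\<integral>\<^sup>+z. ennreal (exp (- c)) * ?V * ennreal (exp (- c * (norm z)\<^sup>2)) \<partial>m)"
    by (simp add: nn_integral_cmult)
  also have "\<dots> \<le> (\<integral>\<^sup>+z. \<integral>\<^sup>+y. ennreal (exp (- (c / 2) * (norm y)\<^sup>2)) * indicator {x. dist (fst x) (snd x) \<le> 1} (y, z) \<partial>lborel \<partial>m)"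
  proof (rule nn_integral_mono)
    fix z :: 'a
    have "ennreal (exp (- c)) * ?V * ennreal (exp (- c * (norm z)\<^sup>2))
        = ennreal (exp (- c - c * (norm z)\<^sup>2)) * emeasure lborel (cball z 1)"
      by (simp add: emeasure_cball exp_diff exp_minus field_simps ennreal_mult'[symmetric] mult_ac flip: exp_add)
    also have "\<dots> = (\<integral>\<^sup>+y. ennreal (exp (- c - c * (norm z)\<^sup>2)) * indicator (cball z 1) y \<partial>lborel)"
      by (simp add: nn_integral_cmult_indicator)
    also have "\<dots> \<le> (\<integral>\<^sup>+y. ennreal (exp (- (c / 2) * (norm y)\<^sup>2)) * indicator {x. dist (fst x) (snd x) \<le> 1} (y, z) \<partial>lborel)"
    proof (rule nn_integral_mono)
      fix y :: 'a
      have "- c - c * (norm z)\<^sup>2 \<le> - (c / 2) * (norm y)\<^sup>2" if "dist z y \<le> 1"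
      proof -
        have "norm y \<le> norm z + 1"
          using that norm_triangle_ineq3[of z y] by (simp add: dist_norm)
        then have "(norm y)\<^sup>2 \<le> (norm z + 1)\<^sup>2" by (intro power_mono) auto
        also have "\<dots> \<le> 2 * (norm z)\<^sup>2 + 2"
          using zero_le_power2[of "norm z - 1"] by (simp add: power2_eq_square algebra_simps)
        finally have "(c / 2) * (norm y)\<^sup>2 \<le> (c / 2) * (2 * (norm z)\<^sup>2 + 2)"
          using c by (intro mult_left_mono) auto
        then show ?thesis by (simp add: algebra_simps)
      qed
      then show "ennreal (exp (- c - c * (norm z)\<^sup>2)) * indicator (cball z 1) y
          \<le> ennreal (exp (- (c / 2) * (norm y)\<^sup>2)) * indicator {x. dist (fst x) (snd x) \<le> 1} (y, z)"
        by (auto split: split_indicator simp: dist_commute intro!: ennreal_leI)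
    qed
    finally show "ennreal (exp (- c)) * ?V * ennreal (exp (- c * (norm z)\<^sup>2))
        \<le> (\<integral>\<^sup>+y. ennreal (exp (- (c / 2) * (norm y)\<^sup>2)) * indicator {x. dist (fst x) (snd x) \<le> 1} (y, z) \<partial>lborel)" .
  qed
  also have "\<dots> = (\<integral>\<^sup>+y. \<integral>\<^sup>+z. ennreal (exp (- (c / 2) * (norm y)\<^sup>2)) * indicator {x. dist (fst x) (snd x) \<le> 1} (y, z) \<partial>m \<partial>lborel)"
    by (rule lborel_m.Fubini') simp
  also have "\<dots> \<le> (\<integral>\<^sup>+y. ennreal (exp (- (c / 2) * (norm y)\<^sup>2)) * K \<partial>(lborel :: 'a measure))"
  proof (rule nn_integral_mono)
    fix y :: 'a
    have "(\<integral>\<^sup>+z. ennreal (exp (- (c / 2) * (norm y)\<^sup>2)) * indicator {x. dist (fst x) (snd x) \<le> 1} (y, z) \<partial>m)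
        = (\<integral>\<^sup>+z. ennreal (exp (- (c / 2) * (norm y)\<^sup>2)) * indicator (cball y 1) z \<partial>m)"
      by (intro nn_integral_cong) (auto split: split_indicator)
    also have "\<dots> = ennreal (exp (- (c / 2) * (norm y)\<^sup>2)) * emeasure m (cball y 1)"
      by (rule nn_integral_cmult_indicator) (simp add: sets_m)
    also have "\<dots> \<le> ennreal (exp (- (c / 2) * (norm y)\<^sup>2)) * K"
      using K(2) by (rule mult_left_mono) simp
    finally show "(\<integral>\<^sup>+z. ennreal (exp (- (c / 2) * (norm y)\<^sup>2)) * indicator {x. dist (fst x) (snd x) \<le> 1} (y, z) \<partial>m)
        \<le> ennreal (exp (- (c / 2) * (norm y)\<^sup>2)) * K" .
  qed
  also have "\<dots> = (\<integral>\<^sup>+y. ennreal (exp (- (c / 2) * (norm y)\<^sup>2)) \<partial>(lborel :: 'a measure)) * K"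
    by (rule nn_integral_multc) simp
  also have "\<dots> < \<infinity>"
    using K(1) c integrable_gaussian[of "c / 2", where ?'a = 'a]
    by (auto simp: integrable_iff_bounded ennreal_mult_less_top)
  finally show "(\<integral>\<^sup>+\<xi>. ennreal (norm (exp (- c * (norm \<xi>)\<^sup>2))) \<partial>m) < \<infinity>"
    using V by (auto simp: ennreal_mult_less_top)
qed simp

end

section \<open>The thermalized measure as an image of a Gaussian\<close>

locale coercive_potential = parallel_invariant_measure E E\<^sub>0 m P
  for E E\<^sub>0 :: "'a::euclidean_space set" and m P +
  fixes \<Phi> :: "'a \<Rightarrow> real" and \<beta>\<^sub>0 c b :: real
  assumes \<Phi> [measurable]: "\<Phi> \<in> borel_measurable borel"
    and \<beta>\<^sub>0: "0 < \<beta>\<^sub>0" and c: "0 < c"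
    and coercive: "\<And>y z. z \<in> E \<Longrightarrow> c * ((norm y)\<^sup>2 + (norm z)\<^sup>2) - b \<le> \<beta>\<^sub>0 * (norm (y - z))\<^sup>2 + \<Phi> y"
begin

definition gibbs :: "('a \<times> 'a) measure" where
  "gibbs = density lborel (\<lambda>y. ennreal (exp (- \<Phi> y))) \<Otimes>\<^sub>M m"

definition gaussian_mass :: real where "gaussian_mass = thermal_normalization TYPE('a) 1"

definition spread :: "real \<Rightarrow> 'a \<times> 'a \<Rightarrow> 'a \<times> 'a" where
  "spread \<epsilon> = (\<lambda>(\<xi>, w). (\<xi> + \<epsilon> *\<^sub>R (w - P w), \<xi> - \<epsilon> *\<^sub>R P w))"

definition weight :: "real \<Rightarrow> 'a \<times> 'a \<Rightarrow> real" where
  "weight \<epsilon> = (\<lambda>(\<xi>, w). exp (- (norm w)\<^sup>2) / gaussian_mass * exp (- \<Phi> (\<xi> + \<epsilon> *\<^sub>R (w - P w))))"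

text \<open>
  The measure \<open>rescaled \<epsilon>\<close> is what the thermalization with \<open>\<beta> = \<epsilon> powr (- 2)\<close> becomes under the change
  of variables: all of them are images of densities on one and the same product space. For \<open>\<epsilon> = 0\<close> both
  points collapse to \<open>\<xi>\<close>, and \<open>rescaled 0\<close> is the diagonal concentration.
\<close>

definition rescaled :: "real \<Rightarrow> ('a \<times> 'a) measure" where
  "rescaled \<epsilon> = distr (density (m \<Otimes>\<^sub>M lborel) (\<lambda>x. ennreal (weight \<epsilon> x))) borel (spread \<epsilon>)"

lemma gaussian_mass_pos: "0 < gaussian_mass"
  unfolding gaussian_mass_def by (rule thermal_normalization_pos) simp

lemma spread_measurable [measurable]: "spread \<epsilon> \<in> borel \<Otimes>\<^sub>M borel \<rightarrow>\<^sub>M borel \<Otimes>\<^sub>M borel"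
  unfolding spread_def by measurable

lemma weight_measurable [measurable]: "weight \<epsilon> \<in> borel_measurable (borel \<Otimes>\<^sub>M borel)"
  unfolding weight_def by measurable

lemma weight_nonneg: "0 \<le> weight \<epsilon> x"
  using gaussian_mass_pos by (auto simp: weight_def split: prod.split)

lemma sets_m_lborel [measurable_cong]: "sets (m \<Otimes>\<^sub>M lborel) = sets (borel \<Otimes>\<^sub>M borel)"
  by (intro sets_pair_measure_cong) (auto simp: sets_m)

lemma sets_rescaled [simp, measurable_cong]: "sets (rescaled \<epsilon>) = sets borel"
  by (simp add: rescaled_def)

lemma sets_gibbs [measurable_cong]: "sets gibbs = sets borel"
  unfolding gibbs_def borel_prod[symmetric] by (intro sets_pair_measure_cong) (auto simp: sets_m)

lemma nn_integral_gibbs: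
  assumes [measurable]: "F \<in> borel_measurable (borel \<Otimes>\<^sub>M borel)"
  shows "(\<integral>\<^sup>+x. F x \<partial>gibbs) = (\<integral>\<^sup>+y. \<integral>\<^sup>+z. ennreal (exp (- \<Phi> y)) * F (y, z) \<partial>m \<partial>lborel)"
proof -
  have "(\<integral>\<^sup>+x. F x \<partial>gibbs) = (\<integral>\<^sup>+y. \<integral>\<^sup>+z. F (y, z) \<partial>m \<partial>density lborel (\<lambda>y. ennreal (exp (- \<Phi> y))))"
    unfolding gibbs_def by (rule nn_integral_fst[symmetric]) simp
  also have "\<dots> = (\<integral>\<^sup>+y. ennreal (exp (- \<Phi> y)) * (\<integral>\<^sup>+z. F (y, z) \<partial>m) \<partial>lborel)"
    by (rule nn_integral_density) auto
  also have "\<dots> = (\<integral>\<^sup>+y. \<integral>\<^sup>+z. ennreal (exp (- \<Phi> y)) * F (y, z) \<partial>m \<partial>lborel)"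
    by (simp add: nn_integral_cmult)
  finally show ?thesis .
qed

text \<open>
  The scale \<open>\<epsilon>\<close> with \<open>\<beta> * \<epsilon>\<^sup>2 = 1\<close> turns \<open>exp (- \<beta> * (norm (y - z))\<^sup>2)\<close> into \<open>exp (- (norm w)\<^sup>2)\<close>, and the
  Jacobian \<open>\<epsilon> ^ DIM('a)\<close> cancels against the scaling of the normalisation constant.
\<close>

lemma thermalization_gibbs:
  assumes "0 < \<beta>"
  shows "thermalization \<beta> gibbs = rescaled (\<beta> powr (- 1 / 2))"
proof (rule measure_eqI)
  define \<epsilon> where "\<epsilon> = \<beta> powr (- 1 / 2)"
  have \<epsilon>: "0 < \<epsilon>" "\<beta> * \<epsilon>\<^sup>2 = 1"
    using assms by (simp_all add: \<epsilon>_def powr_minus powr_half_sqrt power_inverse)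
  show "sets (thermalization \<beta> gibbs) = sets (rescaled (\<beta> powr (- 1 / 2)))"
    by (simp add: thermalization_def sets_gibbs)
  fix A assume "A \<in> sets (thermalization \<beta> gibbs)"
  then have A [measurable]: "A \<in> sets (borel \<Otimes>\<^sub>M borel)"
    unfolding borel_prod by (simp add: thermalization_def sets_gibbs)
  define F where "F = (\<lambda>(y, z). ennreal (exp (- \<Phi> y)) * (ennreal (thermal_weight \<beta> y z) * indicator A (y, z)))"
  have [measurable]: "(\<lambda>(y, z). thermal_weight \<beta> y z :: real) \<in> borel_measurable (borel \<Otimes>\<^sub>M (borel :: 'a measure))"
    unfolding thermal_weight_def by measurable
  have [measurable]: "F \<in> borel_measurable (borel \<Otimes>\<^sub>M borel)"
    unfolding F_def by measurable
  have "emeasure (thermalization \<beta> gibbs) A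
      = (\<integral>\<^sup>+x. (case x of (y, z) \<Rightarrow> ennreal (thermal_weight \<beta> y z)) * indicator A x \<partial>gibbs)"
    unfolding thermalization_def
    by (rule emeasure_density) (simp_all add: sets_gibbs measurable_cong_sets[OF sets_gibbs refl] flip: borel_prod)
  also have "\<dots> = (\<integral>\<^sup>+y. \<integral>\<^sup>+z. F (y, z) \<partial>m \<partial>lborel)"
    by (subst nn_integral_gibbs) (simp_all add: F_def)
  also have "\<dots> = ennreal (\<epsilon> ^ DIM('a)) *
      (\<integral>\<^sup>+\<xi>. \<integral>\<^sup>+w. F (\<xi> + \<epsilon> *\<^sub>R (w - P w), \<xi> - \<epsilon> *\<^sub>R P w) \<partial>lborel \<partial>m)"
    by (rule change_of_variables) (use \<epsilon> in auto)
  also have "\<dots> = (\<integral>\<^sup>+\<xi>. \<integral>\<^sup>+w. ennreal (\<epsilon> ^ DIM('a)) * F (\<xi> + \<epsilon> *\<^sub>R (w - P w), \<xi> - \<epsilon> *\<^sub>R P w) \<partial>lborel \<partial>m)"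
    by (simp add: nn_integral_cmult)
  also have "\<dots> = (\<integral>\<^sup>+\<xi>. \<integral>\<^sup>+w. ennreal (weight \<epsilon> (\<xi>, w)) * indicator A (spread \<epsilon> (\<xi>, w)) \<partial>lborel \<partial>m)"
  proof (intro nn_integral_cong)
    fix \<xi> w :: 'a
    let ?y = "\<xi> + \<epsilon> *\<^sub>R (w - P w)" and ?z = "\<xi> - \<epsilon> *\<^sub>R P w"
    have "?y - ?z = \<epsilon> *\<^sub>R w" by (simp add: algebra_simps)
    then have "\<beta> * (norm (?y - ?z))\<^sup>2 = (norm w)\<^sup>2"
      using \<epsilon> by (simp add: power_mult_distrib mult.assoc[symmetric])
    moreover have "thermal_normalization TYPE('a) \<beta> = \<epsilon> ^ DIM('a) * gaussian_mass"
      using thermal_normalization_scale[OF assms] by (simp add: \<epsilon>_def gaussian_mass_def)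
    ultimately have "\<epsilon> ^ DIM('a) * (exp (- \<Phi> ?y) * thermal_weight \<beta> ?y ?z) = weight \<epsilon> (\<xi>, w)"
      using \<epsilon> gaussian_mass_pos by (simp add: thermal_weight_def weight_def field_simps)
    moreover have "0 \<le> thermal_weight \<beta> ?y ?z"
      using thermal_normalization_pos[OF assms, where ?'a = 'a] by (simp add: thermal_weight_def)
    ultimately have "ennreal (weight \<epsilon> (\<xi>, w))
        = ennreal (\<epsilon> ^ DIM('a)) * (ennreal (exp (- \<Phi> ?y)) * ennreal (thermal_weight \<beta> ?y ?z))"
      using \<epsilon> by (metis ennreal_mult exp_ge_zero mult_nonneg_nonneg zero_le_power less_imp_le)
    then show "ennreal (\<epsilon> ^ DIM('a)) * F (?y, ?z)
        = ennreal (weight \<epsilon> (\<xi>, w)) * indicator A (spread \<epsilon> (\<xi>, w))"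
      by (simp add: F_def spread_def mult.assoc)
  qed
  also have "\<dots> = (\<integral>\<^sup>+x. ennreal (weight \<epsilon> x) * indicator A (spread \<epsilon> x) \<partial>(m \<Otimes>\<^sub>M lborel))"
    by (rule lborel.nn_integral_fst) simp
  also have "\<dots> = (\<integral>\<^sup>+x. ennreal (weight \<epsilon> x) * indicator (spread \<epsilon> -` A \<inter> space (m \<Otimes>\<^sub>M lborel)) x \<partial>(m \<Otimes>\<^sub>M lborel))"
    by (intro nn_integral_cong) (auto split: split_indicator simp: space_pair_measure)
  also have "\<dots> = emeasure (density (m \<Otimes>\<^sub>M lborel) (\<lambda>x. ennreal (weight \<epsilon> x))) (spread \<epsilon> -` A \<inter> space (m \<Otimes>\<^sub>M lborel))"
    by (rule emeasure_density[symmetric]) measurable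
  also have "\<dots> = emeasure (rescaled \<epsilon>) A"
    unfolding rescaled_def using A by (subst emeasure_distr) (simp_all add: borel_prod flip: borel_prod)
  finally show "emeasure (thermalization \<beta> gibbs) A = emeasure (rescaled (\<beta> powr (- 1 / 2))) A"
    by (simp add: \<epsilon>_def)
qed

lemma integral_rescaled:
  fixes f :: "'a \<times> 'a \<Rightarrow> real"
  assumes "f \<in> borel_measurable borel"
  shows "integral\<^sup>L (rescaled \<epsilon>) f = (LINT x|(m \<Otimes>\<^sub>M lborel). weight \<epsilon> x * f (spread \<epsilon> x))"
proof -
  have [measurable]: "f \<in> borel_measurable (borel \<Otimes>\<^sub>M borel)" using assms by (simp add: borel_prod)
  have "integral\<^sup>L (rescaled \<epsilon>) f
      = (LINT x|(density (m \<Otimes>\<^sub>M lborel) (\<lambda>x. ennreal (weight \<epsilon> x))). f (spread \<epsilon> x))"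
    unfolding rescaled_def by (rule integral_distr) (simp_all flip: borel_prod)
  also have "\<dots> = (LINT x|(m \<Otimes>\<^sub>M lborel). weight \<epsilon> x *\<^sub>R f (spread \<epsilon> x))"
    by (rule integral_density) (auto simp: weight_nonneg)
  finally show ?thesis by simp
qed

lemma AE_product_fst:
  assumes "AE \<xi> in m. Q \<xi>"
  shows "AE x in m \<Otimes>\<^sub>M lborel. Q (fst x)"
proof -
  obtain N where N: "{\<xi> \<in> space m. \<not> Q \<xi>} \<subseteq> N" "emeasure m N = 0" "N \<in> sets m"
    using assms by (rule AE_E)
  note N(3) [measurable]
  have N_null: "AE \<xi> in m. \<xi> \<notin> N" using N by (intro AE_not_in) (simp add: null_sets_def)
  have "AE x in m \<Otimes>\<^sub>M lborel. fst x \<notin> N"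
  proof (rule m_lborel.AE_pair_measure)
    show "{x \<in> space (m \<Otimes>\<^sub>M lborel). fst x \<notin> N} \<in> sets (m \<Otimes>\<^sub>M lborel)" by measurable
    show "AE x in m. AE y in lborel. fst (x, y) \<notin> N"
      by (rule AE_mp[OF N_null AE_I2]) auto
  qed
  then show ?thesis by eventually_elim (use N in auto)
qed

lemmas carried_product = AE_product_fst[OF carried]

text \<open>
  Coercivity at the pair \<open>(\<xi> + \<eta>, \<xi>)\<close>: the loss \<open>\<beta>\<^sub>0 * (norm \<eta>)\<^sup>2\<close> is at most half of the Gaussian exponent
  once \<open>\<epsilon>\<close> is small. The bound is uniform in \<open>\<epsilon>\<close>.
\<close>

lemma exp_potential_le:
  assumes "\<xi> \<in> E" "0 \<le> \<epsilon>" "\<epsilon>\<^sup>2 * \<beta>\<^sub>0 \<le> 1 / 2" "norm \<eta> \<le> \<epsilon> * norm w"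
  shows "exp (- \<Phi> (\<xi> + \<eta>)) \<le> exp b * exp (- c * (norm \<xi>)\<^sup>2) * exp ((norm w)\<^sup>2 / 2)"
proof -
  have "(norm \<eta>)\<^sup>2 \<le> (\<epsilon> * norm w)\<^sup>2" using assms(4) by (intro power_mono) auto
  then have "\<beta>\<^sub>0 * (norm \<eta>)\<^sup>2 \<le> \<epsilon>\<^sup>2 * \<beta>\<^sub>0 * (norm w)\<^sup>2"
    using \<beta>\<^sub>0 by (simp add: power_mult_distrib mult_left_mono algebra_simps)
  also have "\<dots> \<le> 1 / 2 * (norm w)\<^sup>2" using assms(3) by (rule mult_right_mono) simp
  finally have "\<beta>\<^sub>0 * (norm \<eta>)\<^sup>2 \<le> (norm w)\<^sup>2 / 2" by simp
  moreover have "c * (norm \<xi>)\<^sup>2 - b \<le> \<beta>\<^sub>0 * (norm \<eta>)\<^sup>2 + \<Phi> (\<xi> + \<eta>)"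
    using coercive[OF assms(1), of "\<xi> + \<eta>"] c
    by (simp add: distrib_left) (smt (verit) mult_nonneg_nonneg zero_le_power2)
  ultimately show ?thesis by (simp flip: exp_add)
qed

lemma weight_le:
  assumes "\<xi> \<in> E" "0 \<le> \<epsilon>" "\<epsilon>\<^sup>2 * \<beta>\<^sub>0 \<le> 1 / 2"
  shows "weight \<epsilon> (\<xi>, w) \<le> exp b / gaussian_mass * exp (- c * (norm \<xi>)\<^sup>2) * exp (- (1 / 2) * (norm w)\<^sup>2)"
proof -
  have "norm (\<epsilon> *\<^sub>R (w - P w)) \<le> \<epsilon> * norm w"
    using assms(2) norm_split(2)[of w] by (simp add: mult_left_mono)
  from exp_potential_le[OF assms this]
  have "weight \<epsilon> (\<xi>, w) \<le> exp (- (norm w)\<^sup>2) / gaussian_mass * (exp b * exp (- c * (norm \<xi>)\<^sup>2) * exp ((norm w)\<^sup>2 / 2))"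
    unfolding weight_def prod.case using gaussian_mass_pos by (intro mult_left_mono) auto
  also have "\<dots> = exp b / gaussian_mass * exp (- c * (norm \<xi>)\<^sup>2) * (exp (- (norm w)\<^sup>2) * exp ((norm w)\<^sup>2 / 2))"
    by simp
  also have "exp (- (norm w)\<^sup>2) * exp ((norm w)\<^sup>2 / 2) = exp (- (1 / 2) * (norm w)\<^sup>2)"
    by (simp flip: exp_add)
  finally show ?thesis .
qed

lemma integrable_gaussian_product:
  "integrable (m \<Otimes>\<^sub>M lborel) (\<lambda>(\<xi>, w). exp (- c * (norm \<xi>)\<^sup>2) * exp (- (1 / 2) * (norm w)\<^sup>2))"
  by (intro m_lborel.integrable_product integrable_gaussian_m integrable_gaussian c) simp

lemma weight_dominated:
  assumes "0 \<le> \<epsilon>" "\<epsilon>\<^sup>2 * \<beta>\<^sub>0 \<le> 1 / 2"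
  shows "AE x in m \<Otimes>\<^sub>M lborel. weight \<epsilon> x \<le>
    exp b / gaussian_mass * (case x of (\<xi>, w) \<Rightarrow> exp (- c * (norm \<xi>)\<^sup>2) * exp (- (1 / 2) * (norm w)\<^sup>2))"
  using carried_product by eventually_elim (use weight_le[OF _ assms] in \<open>auto simp: mult.assoc\<close>)

lemma integrable_weight:
  assumes "0 \<le> \<epsilon>" "\<epsilon>\<^sup>2 * \<beta>\<^sub>0 \<le> 1 / 2"
  shows "integrable (m \<Otimes>\<^sub>M lborel) (weight \<epsilon>)"
proof (rule Bochner_Integration.integrable_bound)
  show "integrable (m \<Otimes>\<^sub>M lborel) (\<lambda>x. exp b / gaussian_mass *
      (case x of (\<xi>, w) \<Rightarrow> exp (- c * (norm \<xi>)\<^sup>2) * exp (- (1 / 2) * (norm w)\<^sup>2)))"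
    using integrable_gaussian_product by (rule integrable_mult_right)
  show "AE x in m \<Otimes>\<^sub>M lborel. norm (weight \<epsilon> x) \<le> norm (exp b / gaussian_mass *
      (case x of (\<xi>, w) \<Rightarrow> exp (- c * (norm \<xi>)\<^sup>2) * exp (- (1 / 2) * (norm w)\<^sup>2)))"
    using weight_dominated[OF assms] by eventually_elim (use weight_nonneg[of \<epsilon>] gaussian_mass_pos in auto)
qed simp

lemma finite_rescaled:
  assumes "0 \<le> \<epsilon>" "\<epsilon>\<^sup>2 * \<beta>\<^sub>0 \<le> 1 / 2"
  shows "finite_radon_measure (rescaled \<epsilon>)"
proof -
  have "finite_measure (density (m \<Otimes>\<^sub>M lborel) (\<lambda>x. ennreal (weight \<epsilon> x)))"
    using integrable_weight[OF assms] weight_nonneg[of \<epsilon>]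
    by (intro finite_measureI, unfold space_density, subst emeasure_density[OF _ sets.top])
      (auto simp: nn_integral_eq_integral cong: nn_integral_cong)
  then interpret finite_measure "rescaled \<epsilon>"
    unfolding rescaled_def by (rule finite_measure.finite_measure_distr) (simp flip: borel_prod)
  show ?thesis
    unfolding finite_radon_measure_def radon_measure_def
    using finite_measure_axioms by (auto simp: less_top[symmetric])
qed

lemma radon_gibbs: "radon_measure gibbs"
  unfolding radon_measure_def
proof (intro conjI allI impI)
  show "sets gibbs = sets borel" by (rule sets_gibbs)
  fix K :: "('a \<times> 'a) set" assume "compact K"
  then have K: "bounded K" by (rule compact_imp_bounded)
  have bdd: "bounded (fst ` K)" "bounded (snd ` K)" using K by (auto intro: bounded_fst bounded_snd)
  obtain R where R: "0 < R" "\<And>y. y \<in> fst ` K \<Longrightarrow> norm y \<le> R" "\<And>y. y \<in> snd ` K \<Longrightarrow> norm y \<le> R"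
    using bdd[unfolded bounded_pos] by (metis max.coboundedI1 max.coboundedI2 max.cobounded1 less_le_trans)
  obtain p where p: "p \<in> E" using E_nonempty by blast
  \<comment> \<open>coercivity with \<open>z = p\<close> bounds \<open>\<Phi>\<close> from below on bounded sets\<close>
  define B where "B = exp (\<beta>\<^sub>0 * (R + norm p)\<^sup>2 + b)"
  have exp_le: "exp (- \<Phi> y) \<le> B" if "norm y \<le> R" for y
  proof -
    have "norm (y - p) \<le> R + norm p" using that norm_triangle_ineq4[of y p] by linarith
    then have "\<beta>\<^sub>0 * (norm (y - p))\<^sup>2 \<le> \<beta>\<^sub>0 * (R + norm p)\<^sup>2"
      using \<beta>\<^sub>0 by (intro mult_left_mono power_mono) auto
    moreover have "0 \<le> c * ((norm y)\<^sup>2 + (norm p)\<^sup>2)" using c by simp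
    ultimately show ?thesis using coercive[OF p, of y] by (simp add: B_def)
  qed
  have [measurable]: "cball (0::'a) R \<in> sets borel" by simp
  have "emeasure gibbs K \<le> emeasure gibbs (cball 0 R \<times> cball 0 R)"
  proof (rule emeasure_mono)
    show "K \<subseteq> cball 0 R \<times> cball 0 R" using R by force
    show "cball 0 R \<times> cball 0 R \<in> sets gibbs" by (simp add: sets_gibbs flip: borel_prod)
  qed
  also have "\<dots> = (\<integral>\<^sup>+x. indicator (cball 0 R \<times> cball 0 R) x \<partial>gibbs)"
    by (subst nn_integral_indicator) (simp_all add: sets_gibbs flip: borel_prod)
  also have "\<dots> = (\<integral>\<^sup>+y. \<integral>\<^sup>+z. ennreal (exp (- \<Phi> y)) * indicator (cball 0 R \<times> cball 0 R) (y, z) \<partial>m \<partial>lborel)"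
    by (rule nn_integral_gibbs) simp
  also have "\<dots> \<le> (\<integral>\<^sup>+y. \<integral>\<^sup>+z. ennreal B * indicator (cball 0 R) y * indicator (cball 0 R) z \<partial>m \<partial>(lborel :: 'a measure))"
    using exp_le by (intro nn_integral_mono) (auto split: split_indicator intro!: ennreal_leI)
  also have "\<dots> = (\<integral>\<^sup>+y. ennreal B * indicator (cball 0 R) y * emeasure m (cball 0 R) \<partial>(lborel :: 'a measure))"
    by (intro nn_integral_cong nn_integral_cmult_indicator) (simp add: sets_m)
  also have "\<dots> = (\<integral>\<^sup>+y. ennreal B * indicator (cball 0 R) y \<partial>(lborel :: 'a measure)) * emeasure m (cball 0 R)"
    by (rule nn_integral_multc) measurable
  also have "(\<integral>\<^sup>+y. ennreal B * indicator (cball 0 R) y \<partial>(lborel :: 'a measure)) = ennreal B * emeasure lborel (cball (0::'a) R)"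
    by (rule nn_integral_cmult_indicator) simp
  also have "ennreal B * emeasure lborel (cball (0::'a) R) * emeasure m (cball 0 R) < \<infinity>"
    using finite_on_bounded[of "cball 0 R"] R(1) by (auto simp: ennreal_mult_less_top emeasure_cball)
  finally show "emeasure gibbs K < \<infinity>" .
qed

lemma integrable_exp_m: "integrable m (\<lambda>\<xi>. exp (- \<Phi> \<xi>))"
proof (rule Bochner_Integration.integrable_bound)
  show "integrable m (\<lambda>\<xi>. exp b * exp (- c * (norm \<xi>)\<^sup>2))"
    using integrable_gaussian_m[OF c] by (rule integrable_mult_right)
  show "AE \<xi> in m. norm (exp (- \<Phi> \<xi>)) \<le> norm (exp b * exp (- c * (norm \<xi>)\<^sup>2))"
    using carried by eventually_elim (use exp_potential_le[of _ 0 0 0] in auto)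
qed simp

lemma integrable_bounded_exp_m:
  fixes f :: "'a \<Rightarrow> real"
  assumes [measurable]: "f \<in> borel_measurable borel" and bnd: "\<And>x. \<bar>f x\<bar> \<le> M"
  shows "integrable m (\<lambda>\<xi>. f \<xi> * exp (- \<Phi> \<xi>))"
proof (rule Bochner_Integration.integrable_bound)
  show "integrable m (\<lambda>\<xi>. M * exp (- \<Phi> \<xi>))"
    using integrable_exp_m by (rule integrable_mult_right)
  have "0 \<le> M" using bnd[of undefined] by linarith
  then show "AE \<xi> in m. norm (f \<xi> * exp (- \<Phi> \<xi>)) \<le> norm (M * exp (- \<Phi> \<xi>))"
    using bnd by (auto simp: abs_mult intro: mult_right_mono)
qed simp

text \<open>
  At \<open>\<epsilon> = 0\<close> the integrand splits into a function of \<open>\<xi>\<close> and the normalised Gaussian in \<open>w\<close>.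
\<close>

lemma integral_rescaled_0:
  fixes f :: "'a \<times> 'a \<Rightarrow> real"
  assumes f: "f \<in> borel_measurable borel" and bnd: "\<And>x. \<bar>f x\<bar> \<le> M"
  shows "integral\<^sup>L (rescaled 0) f = (LINT \<xi>|m. f (\<xi>, \<xi>) * exp (- \<Phi> \<xi>))"
proof -
  have [measurable]: "f \<in> borel_measurable (borel \<Otimes>\<^sub>M borel)" using f by (simp add: borel_prod)
  have gauss: "(LINT w::'a|lborel. exp (- (norm w)\<^sup>2)) = gaussian_mass"
    by (simp add: gaussian_mass_def thermal_normalization_def)
  have prod: "(\<lambda>x. weight 0 x * f (spread 0 x))
      = (\<lambda>(\<xi>, w). f (\<xi>, \<xi>) * exp (- \<Phi> \<xi>) * (exp (- (norm w)\<^sup>2) / gaussian_mass))"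
    by (auto simp: weight_def spread_def fun_eq_iff)
  have "integrable (m \<Otimes>\<^sub>M lborel) (\<lambda>(\<xi>, w::'a). f (\<xi>, \<xi>) * exp (- \<Phi> \<xi>) * (exp (- (norm w)\<^sup>2) / gaussian_mass))"
    using integrable_gaussian[of 1, where ?'a = 'a]
    by (intro m_lborel.integrable_product integrable_bounded_exp_m[of _ M] Bochner_Integration.integrable_divide bnd)
      auto
  then have "integral\<^sup>L (rescaled 0) f
      = (LINT \<xi>|m. LINT w::'a|lborel. f (\<xi>, \<xi>) * exp (- \<Phi> \<xi>) * (exp (- (norm w)\<^sup>2) / gaussian_mass))"
    unfolding integral_rescaled[OF f] prod by (subst m_lborel.integral_fst) auto
  also have "\<dots> = (LINT \<xi>|m. f (\<xi>, \<xi>) * exp (- \<Phi> \<xi>))"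
    using gauss gaussian_mass_pos by simp
  finally show ?thesis .
qed

end

section \<open>Lipschitz test functions and convergence\<close>

text \<open>
  Replacing powers by exponentials lets all growth in \<open>norm w\<close> be absorbed into half of the remaining
  Gaussian at once, through the next lemma.
\<close>

lemma real_power_le_exp:
  assumes "0 \<le> r" "r \<le> s" "0 \<le> \<gamma>"
  shows "real_power r \<gamma> \<le> exp (\<gamma> * s)"
proof (cases "r = 0 \<or> \<gamma> = 0")
  case True
  then show ?thesis using assms by (auto simp: real_power_def)
next
  case False
  then have "0 < r" "0 < \<gamma>" using assms by auto
  moreover have "ln r \<le> s" using ln_less_self[OF \<open>0 < r\<close>] assms(2) by linarith
  ultimately show ?thesis by (simp add: real_power_def powr_def)
qed

lemma exp_linear_le_exp_square: "exp (a * r) \<le> exp (a\<^sup>2) * exp (r\<^sup>2 / 4)" for a r :: real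
proof -
  have "0 \<le> (a - r / 2)\<^sup>2" by simp
  then have "a * r \<le> a\<^sup>2 + r\<^sup>2 / 4" by (simp add: power2_eq_square algebra_simps)
  then show ?thesis by (simp flip: exp_add)
qed

lemma BL_norm_le_1D:
  fixes f :: "'a::metric_space \<Rightarrow> real"
  assumes "bounded_lipschitz f" "BL_norm l f \<le> 1" "0 < l"
  shows "\<bar>f x\<bar> \<le> 1" "\<bar>f x - f y\<bar> \<le> 1 / l * dist x y"
proof -
  have "bdd_above (range (\<lambda>x. \<bar>f x\<bar>))"
    using assms(1) by (auto simp: bounded_lipschitz_def bounded_real bdd_above_def)
  then have "\<bar>f x\<bar> \<le> sup_norm f" unfolding sup_norm_def by (rule cSUP_upper[OF UNIV_I])
  also have "\<dots> \<le> 1" using assms(2) by (simp add: BL_norm_def)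
  finally show "\<bar>f x\<bar> \<le> 1" .
  have Lip: "lipschitz_constant f \<le> 1 / l"
    using assms(2,3) by (simp add: BL_norm_def field_simps)
  show "\<bar>f x - f y\<bar> \<le> 1 / l * dist x y"
  proof (cases "x = y")
    case False
    then have d: "0 < dist x y" by simp
    have "\<bar>f x - f y\<bar> / dist x y \<le> lipschitz_constant f"
      unfolding lipschitz_constant_def
    proof (rule cInf_greatest)
      show "{L. lipschitz_on L UNIV f} \<noteq> {}" using assms(1) by (auto simp: bounded_lipschitz_def)
      fix L assume "L \<in> {L. lipschitz_on L UNIV f}"
      then have "dist (f x) (f y) \<le> L * dist x y" by (auto simp: lipschitz_on_def)
      then show "\<bar>f x - f y\<bar> / dist x y \<le> L" using d by (simp add: dist_real_def field_simps)
    qed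
    also note Lip
    finally show ?thesis using d by (simp add: field_simps)
  qed simp
qed

text \<open>
  The function \<open>u\<close> may fail to be Borel measurable; \<open>g\<close> is an integrable Borel majorant of
  \<open>u \<xi> * exp (- c * (norm \<xi>)\<^sup>2)\<close> almost everywhere.
\<close>

locale transversal_potential = coercive_potential E E\<^sub>0 m P \<Phi> \<beta>\<^sub>0 c b
  for E E\<^sub>0 :: "'a::euclidean_space set" and m P \<Phi> \<beta>\<^sub>0 c b +
  fixes D :: "'a \<Rightarrow> 'a \<Rightarrow> 'a" and u g :: "'a \<Rightarrow> real" and C \<gamma> :: real
  assumes deriv: "\<And>\<xi> \<eta>. \<xi> \<in> E \<Longrightarrow> \<eta> \<in> orthogonal_comp E\<^sub>0 \<Longrightarrow>
      ((\<lambda>h. \<Phi> (\<xi> + h)) has_derivative (\<lambda>h. D \<xi> \<eta> \<bullet> h)) (at \<eta> within orthogonal_comp E\<^sub>0)"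
    and D_bound: "\<And>\<xi> \<eta>. \<xi> \<in> E \<Longrightarrow> \<eta> \<in> orthogonal_comp E\<^sub>0 \<Longrightarrow>
      norm (D \<xi> \<eta>) \<le> C * (1 + u \<xi> + real_power (norm \<eta>) \<gamma>)"
    and C: "0 < C" and \<gamma>: "0 \<le> \<gamma>" and u_nonneg: "\<And>\<xi>. \<xi> \<in> E \<Longrightarrow> 0 \<le> u \<xi>"
    and g_integrable: "integrable m g"
    and u_le_g: "AE \<xi> in m. u \<xi> * exp (- c * (norm \<xi>)\<^sup>2) \<le> g \<xi>"
begin

text \<open>
  The mean value theorem on the segment from \<open>\<xi>\<close> to \<open>\<xi> + \<epsilon> *\<^sub>R (w - P w)\<close>, which is orthogonal to \<open>E\<^sub>0\<close>: the
  gradient of \<open>exp (- \<Phi>)\<close> there is bounded by the coercivity bound times the growth bound for \<open>D\<close>.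
\<close>

lemma exp_potential_diff:
  assumes \<xi>: "\<xi> \<in> E" and \<epsilon>: "0 \<le> \<epsilon>" "\<epsilon> \<le> 1" "\<epsilon>\<^sup>2 * \<beta>\<^sub>0 \<le> 1 / 2"
  shows "\<bar>exp (- \<Phi> (\<xi> + \<epsilon> *\<^sub>R (w - P w))) - exp (- \<Phi> \<xi>)\<bar>
    \<le> \<epsilon> * (exp b * exp (- c * (norm \<xi>)\<^sup>2) * exp ((norm w)\<^sup>2 / 2) *
        (C * (1 + u \<xi> + exp (\<gamma> * norm w)))) * norm w"
proof -
  define \<eta> where "\<eta> = \<epsilon> *\<^sub>R (w - P w)"
  have \<eta>: "norm \<eta> \<le> \<epsilon> * norm w" "norm \<eta> \<le> norm w"
  proof -
    show *: "norm \<eta> \<le> \<epsilon> * norm w"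
      using \<epsilon> norm_split(2)[of w] by (simp add: \<eta>_def mult_left_mono)
    also have "\<dots> \<le> 1 * norm w" using \<epsilon> by (intro mult_right_mono) auto
    finally show "norm \<eta> \<le> norm w" by simp
  qed
  define A where "A = exp b * exp (- c * (norm \<xi>)\<^sup>2) * exp ((norm w)\<^sup>2 / 2)"
  define B where "B = A * (C * (1 + u \<xi> + exp (\<gamma> * norm w)))"
  have "0 \<le> A" by (simp add: A_def)
  have "0 \<le> B" using \<open>0 \<le> A\<close> C u_nonneg[OF \<xi>] by (simp add: B_def)
  have sub: "subspace (orthogonal_comp E\<^sub>0)" by (rule subspace_orthogonal_comp)
  have \<eta>_orth: "\<eta> \<in> orthogonal_comp E\<^sub>0"
    unfolding \<eta>_def using sub P_orthogonal by (rule subspace_scale)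
  let ?S = "closed_segment 0 \<eta>"
  have S: "x \<in> orthogonal_comp E\<^sub>0" "norm x \<le> norm \<eta>" if "x \<in> ?S" for x
    using that \<eta>_orth sub by (auto simp: in_segment subspace_scale mult_left_le_one_le)
  have "norm (exp (- \<Phi> (\<xi> + \<eta>)) - exp (- \<Phi> (\<xi> + 0))) \<le> B * norm (\<eta> - 0)"
  proof (rule differentiable_bound[where S = ?S and f = "\<lambda>x. exp (- \<Phi> (\<xi> + x))"
        and f' = "\<lambda>x h. exp (- \<Phi> (\<xi> + x)) * - (D \<xi> x \<bullet> h)"])
    fix x assume x: "x \<in> ?S"
    have "((\<lambda>h. \<Phi> (\<xi> + h)) has_derivative (\<lambda>h. D \<xi> x \<bullet> h)) (at x within ?S)"
      using deriv[OF \<xi> S(1)[OF x]] by (rule has_derivative_subset) (use S in auto)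
    then show "((\<lambda>x. exp (- \<Phi> (\<xi> + x))) has_derivative (\<lambda>h. exp (- \<Phi> (\<xi> + x)) * - (D \<xi> x \<bullet> h)))
        (at x within ?S)"
      by (auto intro!: derivative_eq_intros)
    have "exp (- \<Phi> (\<xi> + x)) \<le> A"
      unfolding A_def using exp_potential_le[OF \<xi> \<epsilon>(1,3)] S(2)[OF x] \<eta>(1) by (meson order_trans)
    moreover have "norm (D \<xi> x) \<le> C * (1 + u \<xi> + exp (\<gamma> * norm w))"
    proof -
      have "real_power (norm x) \<gamma> \<le> exp (\<gamma> * norm w)"
        using S(2)[OF x] \<eta>(2) \<gamma> by (intro real_power_le_exp) auto
      then have "C * (1 + u \<xi> + real_power (norm x) \<gamma>) \<le> C * (1 + u \<xi> + exp (\<gamma> * norm w))"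
        using C by simp
      with D_bound[OF \<xi> S(1)[OF x]] show ?thesis by linarith
    qed
    ultimately have "exp (- \<Phi> (\<xi> + x)) * norm (D \<xi> x) \<le> B"
      unfolding B_def using \<open>0 \<le> A\<close> by (intro mult_mono) auto
    moreover have "norm (exp (- \<Phi> (\<xi> + x)) * - (D \<xi> x \<bullet> h)) \<le> exp (- \<Phi> (\<xi> + x)) * norm (D \<xi> x) * norm h" for h
      by (simp add: abs_mult mult.assoc Cauchy_Schwarz_ineq2)
    ultimately show "onorm (\<lambda>h. exp (- \<Phi> (\<xi> + x)) * - (D \<xi> x \<bullet> h)) \<le> B"
      by (intro onorm_le) (meson mult_right_mono norm_ge_zero order_trans)
  qed auto
  also have "B * norm (\<eta> - 0) \<le> B * (\<epsilon> * norm w)"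
    using \<eta>(1) \<open>0 \<le> B\<close> by (intro mult_left_mono) auto
  finally show ?thesis by (simp add: \<eta>_def B_def A_def mult_ac)
qed

lemma weight_diff:
  assumes "\<xi> \<in> E" "0 \<le> \<epsilon>" "\<epsilon> \<le> 1" "\<epsilon>\<^sup>2 * \<beta>\<^sub>0 \<le> 1 / 2"
  shows "\<bar>weight \<epsilon> (\<xi>, w) - weight 0 (\<xi>, w)\<bar>
    \<le> \<epsilon> * (exp b / gaussian_mass * exp (- c * (norm \<xi>)\<^sup>2) * exp (- (1 / 2) * (norm w)\<^sup>2) *
        (C * (1 + u \<xi> + exp (\<gamma> * norm w))) * norm w)"
proof -
  have "weight \<epsilon> (\<xi>, w) - weight 0 (\<xi>, w)
      = exp (- (norm w)\<^sup>2) / gaussian_mass * (exp (- \<Phi> (\<xi> + \<epsilon> *\<^sub>R (w - P w))) - exp (- \<Phi> \<xi>))"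
    by (simp add: weight_def right_diff_distrib diff_divide_distrib)
  then have "\<bar>weight \<epsilon> (\<xi>, w) - weight 0 (\<xi>, w)\<bar>
      = exp (- (norm w)\<^sup>2) / gaussian_mass * \<bar>exp (- \<Phi> (\<xi> + \<epsilon> *\<^sub>R (w - P w))) - exp (- \<Phi> \<xi>)\<bar>"
    using gaussian_mass_pos by (simp add: abs_mult)
  also have "\<dots> \<le> exp (- (norm w)\<^sup>2) / gaussian_mass * (\<epsilon> * (exp b * exp (- c * (norm \<xi>)\<^sup>2) * exp ((norm w)\<^sup>2 / 2) *
        (C * (1 + u \<xi> + exp (\<gamma> * norm w)))) * norm w)"
    using gaussian_mass_pos by (intro mult_left_mono exp_potential_diff assms) auto
  also have "\<dots> = \<epsilon> * (exp b / gaussian_mass * exp (- c * (norm \<xi>)\<^sup>2) * (exp (- (norm w)\<^sup>2) * exp ((norm w)\<^sup>2 / 2)) *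
        (C * (1 + u \<xi> + exp (\<gamma> * norm w))) * norm w)"
    by (simp add: mult_ac)
  also have "exp (- (norm w)\<^sup>2) * exp ((norm w)\<^sup>2 / 2) = exp (- (1 / 2) * (norm w)\<^sup>2)"
    by (simp flip: exp_add)
  finally show ?thesis .
qed

lemma dist_spread:
  assumes "0 \<le> \<epsilon>"
  shows "dist (spread \<epsilon> (\<xi>, w)) (spread 0 (\<xi>, w)) \<le> \<epsilon> * (2 * norm w)"
proof -
  have "dist (spread \<epsilon> (\<xi>, w)) (spread 0 (\<xi>, w)) = norm (\<epsilon> *\<^sub>R (w - P w), - \<epsilon> *\<^sub>R P w)"
    by (simp add: spread_def dist_norm)
  also have "\<dots> \<le> norm (\<epsilon> *\<^sub>R (w - P w)) + norm (- \<epsilon> *\<^sub>R P w)" by (rule norm_Pair_le)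
  also have "\<dots> = \<epsilon> * (norm (w - P w) + norm (P w))" using assms by (simp add: distrib_left)
  also have "\<dots> \<le> \<epsilon> * (2 * norm w)"
    using assms norm_split[of w] by (intro mult_left_mono) auto
  finally show ?thesis .
qed

text \<open>
  The difference of the two integrands is at most \<open>\<epsilon>\<close> times a fixed integrable function. It consists of
  the error from moving the argument of \<open>f\<close>, controlled by the Lipschitz constant, and the error from
  moving the argument of \<open>exp (- \<Phi>)\<close>, controlled by the mean value estimate.
\<close>

lemma rescaled_lipschitz_estimate:
  assumes "0 \<le> L"
  shows "\<exists>K>0. \<forall>\<epsilon> f. 0 \<le> \<epsilon> \<longrightarrow> \<epsilon> \<le> 1 \<longrightarrow> \<epsilon>\<^sup>2 * \<beta>\<^sub>0 \<le> 1 / 2 \<longrightarrow>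
    (\<forall>x. \<bar>f x\<bar> \<le> 1) \<longrightarrow> (\<forall>x y. \<bar>f x - f y\<bar> \<le> L * dist x y) \<longrightarrow>
    integral\<^sup>L (rescaled \<epsilon>) f - integral\<^sup>L (rescaled 0) f \<le> \<epsilon> * K"
proof -
  \<comment> \<open>the factor \<open>exp ((\<gamma> + 1)\<^sup>2)\<close> pays for replacing \<open>exp ((\<gamma> + 1) * norm w)\<close> by \<open>exp ((norm w)\<^sup>2 / 4)\<close>\<close>
  define K\<^sub>0 where "K\<^sub>0 = exp b / gaussian_mass * exp ((\<gamma> + 1)\<^sup>2)"
  have K0: "0 < K\<^sub>0" using gaussian_mass_pos by (simp add: K\<^sub>0_def)
  define h where "h = (\<lambda>(\<xi>, w::'a). K\<^sub>0 * ((2 * L + 2 * C) * exp (- c * (norm \<xi>)\<^sup>2) + C * g \<xi>) * exp (- (1 / 4) * (norm w)\<^sup>2))"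
  have h_int: "integrable (m \<Otimes>\<^sub>M lborel) h"
    unfolding h_def
    by (intro m_lborel.integrable_product integrable_gaussian integrable_mult_right
        Bochner_Integration.integrable_add integrable_gaussian_m c g_integrable) simp
  have g_product: "AE x in m \<Otimes>\<^sub>M lborel. u (fst x) * exp (- c * (norm (fst x))\<^sup>2) \<le> g (fst x)"
    by (rule AE_product_fst[OF u_le_g])
  have main: "integral\<^sup>L (rescaled \<epsilon>) f - integral\<^sup>L (rescaled 0) f \<le> \<epsilon> * integral\<^sup>L (m \<Otimes>\<^sub>M lborel) h"
    if \<epsilon>: "0 \<le> \<epsilon>" "\<epsilon> \<le> 1" "\<epsilon>\<^sup>2 * \<beta>\<^sub>0 \<le> 1 / 2"
      and f1: "\<And>x. \<bar>f x\<bar> \<le> 1" and fL: "\<And>x y. \<bar>f x - f y\<bar> \<le> L * dist x y" for \<epsilon> f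
  proof -
    have "lipschitz_on L UNIV f"
      using fL assms by (intro lipschitz_onI) (auto simp: dist_real_def)
    then have f: "f \<in> borel_measurable borel"
      by (intro borel_measurable_continuous_onI lipschitz_on_continuous_on)
    have [measurable]: "f \<in> borel_measurable (borel \<Otimes>\<^sub>M borel)" using f by (simp add: borel_prod)
    have int: "integrable (m \<Otimes>\<^sub>M lborel) (\<lambda>x. weight \<epsilon> x * f (spread \<epsilon> x))"
      if "0 \<le> \<epsilon>" "\<epsilon>\<^sup>2 * \<beta>\<^sub>0 \<le> 1 / 2" for \<epsilon>
      using integrable_weight[OF that]
    proof (rule Bochner_Integration.integrable_bound)
      show "AE x in m \<Otimes>\<^sub>M lborel. norm (weight \<epsilon> x * f (spread \<epsilon> x)) \<le> norm (weight \<epsilon> x)"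
        using f1 by (intro AE_I2) (simp add: abs_mult mult_left_le)
    qed simp
    have "AE x in m \<Otimes>\<^sub>M lborel. weight \<epsilon> x * f (spread \<epsilon> x) - weight 0 x * f (spread 0 x) \<le> \<epsilon> * h x"
      using carried_product g_product
    proof eventually_elim
      case (elim x)
      obtain \<xi> w where x: "x = (\<xi>, w)" by (cases x)
      with elim have \<xi>: "\<xi> \<in> E" and u_g: "u \<xi> * exp (- c * (norm \<xi>)\<^sup>2) \<le> g \<xi>" by auto
      define X where "X = exp b / gaussian_mass * exp (- c * (norm \<xi>)\<^sup>2) * exp (- (1 / 2) * (norm w)\<^sup>2)"
      define Y where "Y = exp ((\<gamma> + 1) * norm w)"
      have X: "0 \<le> X" using gaussian_mass_pos by (simp add: X_def)
      have u: "0 \<le> u \<xi>" using \<xi> by (rule u_nonneg)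
      have w_le: "norm w \<le> exp (norm w)" using exp_ge_add_one_self[of "norm w"] by linarith
      have w_le_Y: "norm w \<le> Y"
      proof -
        have "norm w \<le> (\<gamma> + 1) * norm w" using \<gamma> by (simp add: distrib_right)
        then have "exp (norm w) \<le> Y" by (simp add: Y_def)
        with w_le show ?thesis by linarith
      qed
      have poly_le: "(1 + u \<xi> + exp (\<gamma> * norm w)) * norm w \<le> (2 + u \<xi>) * Y"
      proof -
        have "1 \<le> exp (\<gamma> * norm w)" using \<gamma> by simp
        then have "(1 + u \<xi>) * 1 \<le> (1 + u \<xi>) * exp (\<gamma> * norm w)"
          using u by (intro mult_left_mono) auto
        then have "1 + u \<xi> + exp (\<gamma> * norm w) \<le> (2 + u \<xi>) * exp (\<gamma> * norm w)"
          by (simp add: distrib_right)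
        then have "(1 + u \<xi> + exp (\<gamma> * norm w)) * norm w \<le> (2 + u \<xi>) * exp (\<gamma> * norm w) * exp (norm w)"
          using u w_le by (intro mult_mono) auto
        also have "\<dots> = (2 + u \<xi>) * Y" by (simp add: Y_def algebra_simps exp_add)
        finally show ?thesis .
      qed
      have XY: "X * Y \<le> K\<^sub>0 * exp (- c * (norm \<xi>)\<^sup>2) * exp (- (1 / 4) * (norm w)\<^sup>2)"
      proof -
        have "X * Y \<le> X * (exp ((\<gamma> + 1)\<^sup>2) * exp ((norm w)\<^sup>2 / 4))"
          unfolding Y_def using X by (intro mult_left_mono exp_linear_le_exp_square)
        also have "\<dots> = K\<^sub>0 * exp (- c * (norm \<xi>)\<^sup>2) * (exp (- (1 / 2) * (norm w)\<^sup>2) * exp ((norm w)\<^sup>2 / 4))"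
          by (simp add: X_def K\<^sub>0_def mult_ac)
        also have "exp (- (1 / 2) * (norm w)\<^sup>2) * exp ((norm w)\<^sup>2 / 4) = exp (- (1 / 4) * (norm w)\<^sup>2)"
          by (simp flip: exp_add)
        finally show ?thesis .
      qed
      have "weight \<epsilon> x * f (spread \<epsilon> x) - weight 0 x * f (spread 0 x)
          = weight \<epsilon> x * (f (spread \<epsilon> x) - f (spread 0 x)) + (weight \<epsilon> x - weight 0 x) * f (spread 0 x)"
        by (simp add: algebra_simps)
      also have "\<dots> \<le> X * (L * (\<epsilon> * (2 * Y))) + \<epsilon> * (X * C * ((2 + u \<xi>) * Y))"
      proof (rule add_mono)
        have "f (spread \<epsilon> x) - f (spread 0 x) \<le> L * dist (spread \<epsilon> x) (spread 0 x)"
          using fL[of "spread \<epsilon> x" "spread 0 x"] by linarith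
        also have "\<dots> \<le> L * (\<epsilon> * (2 * norm w))"
          unfolding x using dist_spread[OF \<epsilon>(1)] assms by (intro mult_left_mono)
        also have "\<dots> \<le> L * (\<epsilon> * (2 * Y))"
          using assms \<epsilon>(1) w_le_Y by (intro mult_left_mono) auto
        finally have "weight \<epsilon> x * (f (spread \<epsilon> x) - f (spread 0 x)) \<le> weight \<epsilon> x * (L * (\<epsilon> * (2 * Y)))"
          using weight_nonneg by (rule mult_left_mono)
        also have "\<dots> \<le> X * (L * (\<epsilon> * (2 * Y)))"
          unfolding x X_def using weight_le[OF \<xi> \<epsilon>(1,3)] assms \<epsilon>(1) by (intro mult_right_mono) (auto simp: Y_def)
        finally show "weight \<epsilon> x * (f (spread \<epsilon> x) - f (spread 0 x)) \<le> X * (L * (\<epsilon> * (2 * Y)))" .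
        have "(weight \<epsilon> x - weight 0 x) * f (spread 0 x) \<le> \<bar>weight \<epsilon> x - weight 0 x\<bar> * \<bar>f (spread 0 x)\<bar>"
          by (metis abs_ge_self abs_mult)
        also have "\<dots> \<le> \<bar>weight \<epsilon> x - weight 0 x\<bar>"
          using f1 by (intro mult_left_le) auto
        also have "\<dots> \<le> \<epsilon> * (X * C * ((1 + u \<xi> + exp (\<gamma> * norm w)) * norm w))"
          using weight_diff[OF \<xi> \<epsilon>, of w] by (simp add: x X_def mult_ac)
        also have "\<dots> \<le> \<epsilon> * (X * C * ((2 + u \<xi>) * Y))"
          using \<epsilon>(1) X C poly_le by (intro mult_left_mono) auto
        finally show "(weight \<epsilon> x - weight 0 x) * f (spread 0 x) \<le> \<epsilon> * (X * C * ((2 + u \<xi>) * Y))" .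
      qed
      also have "\<dots> = \<epsilon> * ((2 * L + 2 * C + C * u \<xi>) * (X * Y))" by (simp add: algebra_simps)
      also have "\<dots> \<le> \<epsilon> * ((2 * L + 2 * C + C * u \<xi>) * (K\<^sub>0 * exp (- c * (norm \<xi>)\<^sup>2) * exp (- (1 / 4) * (norm w)\<^sup>2)))"
        using \<epsilon>(1) assms C u by (intro mult_left_mono XY) auto
      also have "\<dots> = \<epsilon> * (K\<^sub>0 * ((2 * L + 2 * C) * exp (- c * (norm \<xi>)\<^sup>2) + C * (u \<xi> * exp (- c * (norm \<xi>)\<^sup>2)))
          * exp (- (1 / 4) * (norm w)\<^sup>2))"
        by (simp add: algebra_simps)
      also have "\<dots> \<le> \<epsilon> * h x"
        unfolding h_def x prod.case using \<epsilon>(1) K0 C u_g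
        by (intro mult_left_mono mult_right_mono add_left_mono) auto
      finally show ?case .
    qed
    then have "(LINT x|(m \<Otimes>\<^sub>M lborel). weight \<epsilon> x * f (spread \<epsilon> x) - weight 0 x * f (spread 0 x))
        \<le> (LINT x|(m \<Otimes>\<^sub>M lborel). \<epsilon> * h x)"
      using int[OF \<epsilon>(1,3)] int[of 0] h_int by (intro integral_mono_AE) auto
    then show ?thesis
      unfolding integral_rescaled[OF f] using int[OF \<epsilon>(1,3)] int[of 0] by simp
  qed
  \<comment> \<open>the constant has to be strictly positive even if \<open>m\<close> vanishes\<close>
  define K where "K = \<bar>integral\<^sup>L (m \<Otimes>\<^sub>M lborel) h\<bar> + 1"
  have "\<epsilon> * integral\<^sup>L (m \<Otimes>\<^sub>M lborel) h \<le> \<epsilon> * K" if "0 \<le> \<epsilon>" for \<epsilon>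
    using that by (intro mult_left_mono) (auto simp: K_def)
  then have "integral\<^sup>L (rescaled \<epsilon>) f - integral\<^sup>L (rescaled 0) f \<le> \<epsilon> * K"
    if "0 \<le> \<epsilon>" "\<epsilon> \<le> 1" "\<epsilon>\<^sup>2 * \<beta>\<^sub>0 \<le> 1 / 2" "\<forall>x. \<bar>f x\<bar> \<le> 1" "\<forall>x y. \<bar>f x - f y\<bar> \<le> L * dist x y" for \<epsilon> f
    using main[of \<epsilon> f] that by (meson order_trans)
  moreover have "0 < K" by (simp add: K_def)
  ultimately show ?thesis by blast
qed

lemma scale_small:
  "\<forall>\<^sub>F \<beta> in at_top. 0 < \<beta> \<and> \<beta> powr (- 1 / 2) \<le> 1 \<and> (\<beta> powr (- 1 / 2))\<^sup>2 * \<beta>\<^sub>0 \<le> 1 / 2"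
  using eventually_ge_at_top[of "max 1 (2 * \<beta>\<^sub>0)"]
proof eventually_elim
  case (elim \<beta>)
  then have \<beta>: "1 \<le> \<beta>" "2 * \<beta>\<^sub>0 \<le> \<beta>" by auto
  then have "\<beta> powr (- 1 / 2) = 1 / sqrt \<beta>" by (simp add: powr_minus powr_half_sqrt field_simps)
  moreover from \<beta> have "1 / sqrt \<beta> \<le> 1" "(1 / sqrt \<beta>)\<^sup>2 * \<beta>\<^sub>0 \<le> 1 / 2"
    by (simp_all add: power_divide field_simps)
  ultimately show ?case using \<beta> by simp
qed

text \<open>
  Dominated convergence. The weights converge pointwise by the mean value estimate, and the coercivity
  bound provides the dominating function.
\<close>

lemma narrow_convergence_rescaled:
  "narrow_convergence (\<lambda>\<beta>. rescaled (\<beta> powr (- 1 / 2))) (rescaled 0) at_top"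
  unfolding narrow_convergence_def
proof (intro allI impI)
  fix f :: "'a \<times> 'a \<Rightarrow> real" assume f: "bounded_continuous f"
  then have f_cont: "continuous_on UNIV f" and f_meas: "f \<in> borel_measurable borel"
    by (auto simp: bounded_continuous_def intro: borel_measurable_continuous_onI)
  have [measurable]: "f \<in> borel_measurable (borel \<Otimes>\<^sub>M borel)" using f_meas by (simp add: borel_prod)
  obtain M where M: "\<And>x. \<bar>f x\<bar> \<le> M"
    using f by (auto simp: bounded_continuous_def bounded_real)
  have "0 \<le> M" using M[of undefined] by linarith
  define \<epsilon> :: "real \<Rightarrow> real" where "\<epsilon> \<beta> = \<beta> powr (- 1 / 2)" for \<beta>
  have \<epsilon>_0: "(\<epsilon> \<longlongrightarrow> 0) at_top" unfolding \<epsilon>_def by (rule tendsto_neg_powr) (auto intro: filterlim_ident)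
  define h where "h = (\<lambda>x. exp b / gaussian_mass * (case x of (\<xi>::'a, w::'a) \<Rightarrow> exp (- c * (norm \<xi>)\<^sup>2) * exp (- (1 / 2) * (norm w)\<^sup>2)))"
  have "((\<lambda>\<beta>. LINT x|(m \<Otimes>\<^sub>M lborel). weight (\<epsilon> \<beta>) x * f (spread (\<epsilon> \<beta>) x)) \<longlongrightarrow>
      (LINT x|(m \<Otimes>\<^sub>M lborel). weight 0 x * f (spread 0 x))) at_top"
  proof (rule integral_dominated_convergence_at_top[where w = "\<lambda>x. M * h x"])
    show "integrable (m \<Otimes>\<^sub>M lborel) (\<lambda>x. M * h x)"
      unfolding h_def by (intro integrable_mult_right integrable_gaussian_product)
    show "\<forall>\<^sub>F \<beta> in at_top. AE x in m \<Otimes>\<^sub>M lborel. norm (weight (\<epsilon> \<beta>) x * f (spread (\<epsilon> \<beta>) x)) \<le> M * h x"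
      using scale_small
    proof eventually_elim
      case (elim \<beta>)
      then have "AE x in m \<Otimes>\<^sub>M lborel. weight (\<epsilon> \<beta>) x \<le> h x"
        unfolding h_def by (intro weight_dominated) (auto simp: \<epsilon>_def)
      then show ?case
      proof eventually_elim
        case (elim x)
        have "\<bar>f (spread (\<epsilon> \<beta>) x)\<bar> * weight (\<epsilon> \<beta>) x \<le> M * h x"
          using M elim \<open>0 \<le> M\<close> weight_nonneg by (intro mult_mono) auto
        then show ?case by (simp add: abs_mult weight_nonneg mult.commute)
      qed
    qed
    show "AE x in m \<Otimes>\<^sub>M lborel. ((\<lambda>\<beta>. weight (\<epsilon> \<beta>) x * f (spread (\<epsilon> \<beta>) x)) \<longlongrightarrow> weight 0 x * f (spread 0 x)) at_top"
      using carried_product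
    proof eventually_elim
      case (elim x)
      obtain \<xi> w where x: "x = (\<xi>, w)" by (cases x)
      with elim have \<xi>: "\<xi> \<in> E" by simp
      define k where "k = exp b / gaussian_mass * exp (- c * (norm \<xi>)\<^sup>2) * exp (- (1 / 2) * (norm w)\<^sup>2) *
          (C * (1 + u \<xi> + exp (\<gamma> * norm w))) * norm w"
      have "((\<lambda>\<beta>. weight (\<epsilon> \<beta>) x) \<longlongrightarrow> weight 0 x) at_top"
      proof (rule LIM_zero_cancel, rule Lim_null_comparison)
        show "\<forall>\<^sub>F \<beta> in at_top. norm (weight (\<epsilon> \<beta>) x - weight 0 x) \<le> \<epsilon> \<beta> * k"
          using scale_small
          by eventually_elim (use weight_diff[OF \<xi>, of _ w] in \<open>auto simp: x k_def \<epsilon>_def\<close>)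
        show "((\<lambda>\<beta>. \<epsilon> \<beta> * k) \<longlongrightarrow> 0) at_top"
          using tendsto_mult_right[OF \<epsilon>_0, of k] by simp
      qed
      moreover have "((\<lambda>\<beta>. spread (\<epsilon> \<beta>) x) \<longlongrightarrow> spread 0 x) at_top"
        unfolding x spread_def prod.case by (intro tendsto_intros \<epsilon>_0)
      then have "((\<lambda>\<beta>. f (spread (\<epsilon> \<beta>) x)) \<longlongrightarrow> f (spread 0 x)) at_top"
        by (rule continuous_on_tendsto_compose[OF f_cont]) auto
      ultimately show ?case by (rule tendsto_mult)
    qed
  qed simp_all
  then show "((\<lambda>\<beta>. integral\<^sup>L (rescaled (\<beta> powr (- 1 / 2))) f) \<longlongrightarrow> integral\<^sup>L (rescaled 0) f) at_top"
    unfolding integral_rescaled[OF f_meas] by (simp add: \<epsilon>_def)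
qed

end

section \<open>The restricted Hausdorff measure and the theorem\<close>

lemma orthogonal_projection_exists:
  fixes S :: "'a::euclidean_space set"
  assumes "subspace S"
  obtains P where "linear P" "\<And>v. P v \<in> S" "\<And>v. v - P v \<in> orthogonal_comp S"
proof -
  obtain B where B: "B \<subseteq> S" "pairwise orthogonal B" "\<And>x. x \<in> B \<Longrightarrow> norm x = 1"
      "independent B" "span B = S"
    using orthonormal_basis_subspace[OF assms] by metis
  have finB: "finite B" using \<open>independent B\<close> by (rule independent_imp_finite)
  define P where "P v = (\<Sum>b\<in>B. (v \<bullet> b) *\<^sub>R b)" for v
  have "linear P"
    unfolding P_def by (intro linear_compose_sum ballI linearI) (simp_all add: inner_add_left scaleR_add_left)
  moreover have "P v \<in> S" for v
    unfolding P_def using B(1) by (intro subspace_sum[OF assms] subspace_scale[OF assms]) auto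
  moreover have "v - P v \<in> orthogonal_comp S" for v
  proof -
    have "orthogonal (v - P v) a" if a: "a \<in> B" for a
    proof -
      have "P v \<bullet> a = (\<Sum>b\<in>B. if b = a then v \<bullet> a else 0)"
        unfolding P_def inner_sum_left using B(2,3) a
        by (intro sum.cong) (auto simp: pairwise_def orthogonal_def norm_eq_1)
      then show ?thesis using finB a by (simp add: orthogonal_def inner_diff_left)
    qed
    then have "orthogonal (v - P v) y" if "y \<in> S" for y
      using orthogonal_to_span[of y B "v - P v"] that B(5) by auto
    then show ?thesis by (auto simp: orthogonal_comp_def orthogonal_commute)
  qed
  ultimately show ?thesis by (rule that)
qed

lemma sets_measure_restriction [simp]: "sets (measure_restriction M E) = sets M"
  by (simp add: measure_restriction_def)

lemma emeasure_measure_restriction: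
  "E \<in> sets M \<Longrightarrow> A \<in> sets M \<Longrightarrow> emeasure (measure_restriction M E) A = emeasure M (E \<inter> A)"
  by (simp add: measure_restriction_def emeasure_restricted)

lemma AE_measure_restriction:
  "E \<in> sets M \<Longrightarrow> (AE x in measure_restriction M E. Q x) \<longleftrightarrow> (AE x in M. x \<in> E \<longrightarrow> Q x)"
  unfolding measure_restriction_def by (subst AE_density) (auto simp: indicator_def)

lemma
  fixes f :: "'a \<Rightarrow> real"
  assumes [measurable]: "E \<in> sets M" "f \<in> borel_measurable M"
  shows integrable_measure_restriction:
      "integrable (measure_restriction M E) f \<longleftrightarrow> set_integrable M E f"
    and integral_measure_restriction:
      "integral\<^sup>L (measure_restriction M E) f = (LINT x:E|M. f x)"
proof -
  have "measure_restriction M E = density M (\<lambda>x. ennreal (indicator E x))"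
    by (simp add: measure_restriction_def ennreal_indicator)
  then show "integrable (measure_restriction M E) f \<longleftrightarrow> set_integrable M E f"
      "integral\<^sup>L (measure_restriction M E) f = (LINT x:E|M. f x)"
    by (simp_all add: integrable_density integral_density set_integrable_def set_lebesgue_integral_def)
qed

text \<open>
  \<open>E\<close> is mapped onto itself by translations along its direction space, and the Hausdorff measure is
  invariant under all translations.
\<close>

lemma hausdorff_restriction_invariant:
  fixes E E\<^sub>0 :: "'a::euclidean_space set"
  assumes E [measurable]: "E \<in> sets borel" and E_eq: "E = (+) a ` E\<^sub>0" and "subspace E\<^sub>0" "h \<in> E\<^sub>0"
  shows "distr (measure_restriction (hausdorff_measure n) E) borel ((+) h)
    = measure_restriction (hausdorff_measure n) E" (is "distr ?m _ _ = _")
proof (rule measure_eqI)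
  fix A assume "A \<in> sets (distr ?m borel ((+) h))"
  then have A [measurable]: "A \<in> sets borel" by simp
  have [measurable]: "(+) h -` A \<in> sets borel"
    by (rule measurable_sets_borel[OF _ A]) simp
  have "E \<inter> (+) h -` A = (+) (- h) ` (E \<inter> A)"
  proof (intro set_eqI iffI)
    fix x assume x: "x \<in> E \<inter> (+) h -` A"
    then obtain e where "e \<in> E\<^sub>0" "x = a + e" by (auto simp: E_eq)
    then have "h + x = a + (h + e)" "h + e \<in> E\<^sub>0"
      using assms(3,4) by (auto simp: subspace_add algebra_simps)
    then have "h + x \<in> E" by (auto simp: E_eq)
    then show "x \<in> (+) (- h) ` (E \<inter> A)" using x by (intro image_eqI[of _ _ "h + x"]) auto
  next
    fix x assume "x \<in> (+) (- h) ` (E \<inter> A)"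
    then obtain y where y: "y \<in> E" "y \<in> A" "x = - h + y" by auto
    then obtain e where e: "e \<in> E\<^sub>0" "y = a + e" by (auto simp: E_eq)
    then have "x = a + (e - h)" "e - h \<in> E\<^sub>0"
      using y(3) assms(3,4) by (auto simp: subspace_diff algebra_simps)
    then show "x \<in> E \<inter> (+) h -` A" using y by (auto simp: E_eq)
  qed
  then have "emeasure (hausdorff_measure n) (E \<inter> (+) h -` A) = emeasure (hausdorff_measure n) (E \<inter> A)"
    using emeasure_hausdorff_measure_translation[of "E \<inter> A" n "- h"] by simp
  then show "emeasure (distr ?m borel ((+) h)) A = emeasure ?m A"
    by (subst emeasure_distr)
      (auto simp: emeasure_measure_restriction
        sets_eq_imp_space_eq[of ?m borel] measurable_cong_sets[of ?m borel])
qed simp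

theorem proposition3p4:
  fixes E E\<^sub>0 :: "'a::euclidean_space set"
    and N :: nat
    and \<Phi> :: "'a \<Rightarrow> real"
    and \<mu> :: "('a \<times> 'a) measure"
    and \<Psi> :: "'a \<Rightarrow> 'a \<Rightarrow> real"
    and D\<^sub>2\<Psi> :: "'a \<Rightarrow> 'a \<Rightarrow> 'a"
    and u :: "'a \<Rightarrow> real"
    and \<beta>\<^sub>0 c b C \<gamma> l :: real
  assumes dim_Z: "DIM('a) = 2 * N"
    and E: "affine E" "aff_dim E = int N"
    and \<Phi>: "\<Phi> \<in> borel_measurable borel"
    and \<mu>: "\<mu> = density lborel (\<lambda>y. ennreal (exp (- \<Phi> y)))
                 \<Otimes>\<^sub>M measure_restriction (hausdorff_measure N) E"
    and pos: "\<beta>\<^sub>0 > 0" "c > 0" "b > 0"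
    and coercive: "\<forall>y. \<forall>z\<in>E. \<beta>\<^sub>0 * (norm (y - z))\<^sup>2 + \<Phi> y \<ge> c * ((norm y)\<^sup>2 + (norm z)\<^sup>2) - b"
    and E\<^sub>0: "subspace E\<^sub>0" "affine_parallel E\<^sub>0 E"
    and \<Psi>: "\<forall>\<xi> \<eta>. \<Psi> \<xi> \<eta> = \<Phi> (\<xi> + \<eta>)"
    \<comment> \<open>the partial derivative is represented by its gradient in the orthogonal complement\<close>
    and D2_range: "\<forall>\<xi>\<in>E. \<forall>\<eta>\<in>orthogonal_comp E\<^sub>0. D\<^sub>2\<Psi> \<xi> \<eta> \<in> orthogonal_comp E\<^sub>0"
    and D2_deriv: "\<forall>\<xi>\<in>E. \<forall>\<eta>\<in>orthogonal_comp E\<^sub>0.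
      (\<Psi> \<xi> has_derivative (\<lambda>h. D\<^sub>2\<Psi> \<xi> \<eta> \<bullet> h)) (at \<eta> within orthogonal_comp E\<^sub>0)"
    and D2_cont: "\<forall>\<xi>\<in>E. continuous_on (orthogonal_comp E\<^sub>0) (D\<^sub>2\<Psi> \<xi>)"
    and growth_pos: "C > 0" "\<gamma> \<ge> 0"
    and u_nonneg: "\<forall>\<xi>\<in>E. u \<xi> \<ge> 0"
    and u_int: "set_integrable (completion (hausdorff_measure N)) E
      (\<lambda>\<xi>. u \<xi> * exp (- c * (norm \<xi>)\<^sup>2 / 4))"
    and D2_bound: "\<forall>\<xi>\<in>E. \<forall>\<eta>\<in>orthogonal_comp E\<^sub>0.
      norm (D\<^sub>2\<Psi> \<xi> \<eta>) \<le> C * (1 + u \<xi> + real_power (norm \<eta>) \<gamma>)"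
    and l: "l > 0"
  shows "\<exists>\<nu>. strongly_transversal \<mu> \<nu> \<and>
    (\<forall>f. bounded_continuous f \<longrightarrow>
      set_integrable (hausdorff_measure N) E (\<lambda>\<xi>. f (\<xi>, \<xi>) * exp (- \<Phi> \<xi>)) \<and>
      integral\<^sup>L \<nu> f = (LINT \<xi>:E|hausdorff_measure N. f (\<xi>, \<xi>) * exp (- \<Phi> \<xi>))) \<and>
    (\<exists>C\<^sub>1>0. \<forall>\<^sub>F \<beta> in at_top.
      flat_norm_diff l (thermalization \<beta> \<mu>) \<nu> \<le> ereal (C\<^sub>1 * \<beta> powr (- 1 / 2)))"
proof -
  define H where "H = (hausdorff_measure N :: 'a measure)"
  define m where "m = measure_restriction H E"
  have sets_H [simp, measurable_cong]: "sets H = sets borel" by (simp add: H_def)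
  obtain P where P: "linear P" "\<And>v. P v \<in> E\<^sub>0" "\<And>v. v - P v \<in> orthogonal_comp E\<^sub>0"
    using orthogonal_projection_exists[OF E\<^sub>0(1)] by blast
  obtain a where a: "E = (+) a ` E\<^sub>0" using E\<^sub>0(2) by (auto simp: affine_parallel_def)
  have E_borel [measurable]: "E \<in> sets borel" 
    using closed_affine_hull[of E] E(1) by (simp add: affine_hull_eq[THEN iffD2] borel_closed)
  have E_nonempty: "E \<noteq> {}" using E(2) by auto
  interpret parallel_invariant_measure E E\<^sub>0 m P
  proof (rule parallel_invariant_measure.intro)
    show "sets m = sets borel" by (simp add: m_def)
    show "AE z in m. z \<in> E" unfolding m_def by (subst AE_measure_restriction) auto
    show "emeasure m A < \<infinity>" if A: "bounded A" "A \<in> sets borel" for A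
      using emeasure_hausdorff_measure_affine_finite[OF E, of "E \<inter> A"] A
      by (simp add: m_def H_def emeasure_measure_restriction bounded_Int)
    show "distr m borel ((+) h) = m" if "h \<in> E\<^sub>0" for h
      unfolding m_def H_def using hausdorff_restriction_invariant[OF E_borel a E\<^sub>0(1) that] .
    show "x - y \<in> E\<^sub>0" if "x \<in> E" "y \<in> E" for x y
      using that E\<^sub>0(1) by (auto simp: a subspace_diff)
  qed (fact E_borel E_nonempty E\<^sub>0(1) P)+
  interpret coercive_potential E E\<^sub>0 m P \<Phi> \<beta>\<^sub>0 c b
    by unfold_locales (fact \<Phi> pos coercive[rule_format])+
  define v where "v = (\<lambda>\<xi>. indicator E \<xi> *\<^sub>R (u \<xi> * exp (- c * (norm \<xi>)\<^sup>2 / 4)))"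
  have v_int: "integrable (completion H) v"
    using u_int by (simp add: v_def H_def set_integrable_def)
  \<comment> \<open>\<open>v\<close> is measurable for the completion only; \<open>g\<close> is a Borel version of it\<close>
  obtain g where g [measurable]: "g \<in> borel_measurable H" and g_eq: "AE \<xi> in H. v \<xi> = g \<xi>"
    using completion_ex_borel_measurable_real[OF borel_measurable_integrable[OF v_int]] by blast
  have "integrable (completion H) g"
    by (rule integrable_cong_AE_imp[OF v_int measurable_completion[OF g] AE_completion[OF g_eq]])
  then have g_int: "integrable H g" using integrable_completion[OF g] by simp
  have \<Psi>_eq: "\<Psi> \<xi> = (\<lambda>h. \<Phi> (\<xi> + h))" for \<xi> using \<Psi> by auto
  interpret transversal_potential E E\<^sub>0 m P \<Phi> \<beta>\<^sub>0 c b D\<^sub>2\<Psi> u g C \<gamma>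
  proof
    show "integrable m g"
      unfolding m_def using integrable_mult_indicator[of E H g] g_int
      by (subst integrable_measure_restriction) (simp_all add: set_integrable_def)
    have "AE \<xi> in H. \<xi> \<in> E \<longrightarrow> u \<xi> * exp (- c * (norm \<xi>)\<^sup>2) \<le> g \<xi>"
      using g_eq
    proof eventually_elim
      case (elim \<xi>)
      show ?case
      proof
        assume \<xi>: "\<xi> \<in> E"
        have "u \<xi> * exp (- c * (norm \<xi>)\<^sup>2) \<le> u \<xi> * exp (- c * (norm \<xi>)\<^sup>2 / 4)"
          using u_nonneg \<xi> pos by (intro mult_left_mono) auto
        then show "u \<xi> * exp (- c * (norm \<xi>)\<^sup>2) \<le> g \<xi>" using elim \<xi> by (simp add: v_def)
      qed
    qed
    then show "AE \<xi> in m. u \<xi> * exp (- c * (norm \<xi>)\<^sup>2) \<le> g \<xi>"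
      unfolding m_def by (subst AE_measure_restriction) auto
  qed (use D2_deriv D2_bound growth_pos u_nonneg in \<open>auto simp: \<Psi>_eq\<close>)
  have gibbs: "\<mu> = gibbs" unfolding gibbs_def unfolding \<mu> m_def H_def ..
  have thermal: "\<forall>\<^sub>F \<beta> in at_top. thermalization \<beta> \<mu> = rescaled (\<beta> powr (- 1 / 2))"
    using eventually_gt_at_top[of 0] by eventually_elim (simp add: gibbs thermalization_gibbs)
  have "strongly_transversal \<mu> (rescaled 0)"
    unfolding strongly_transversal_def
  proof (intro conjI)
    show "radon_measure \<mu>" unfolding gibbs by (rule radon_gibbs)
    show "finite_radon_measure (rescaled 0)" by (rule finite_rescaled) auto
    show "\<forall>\<^sub>F \<beta> in at_top. finite_radon_measure (thermalization \<beta> \<mu>)"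
      using thermal scale_small by eventually_elim (auto intro: finite_rescaled)
    show "narrow_convergence (\<lambda>\<beta>. thermalization \<beta> \<mu>) (rescaled 0) at_top"
      unfolding narrow_convergence_def
    proof (intro allI impI)
      fix f :: "'a \<times> 'a \<Rightarrow> real" assume "bounded_continuous f"
      then have "((\<lambda>\<beta>. integral\<^sup>L (rescaled (\<beta> powr (- 1 / 2))) f) \<longlongrightarrow> integral\<^sup>L (rescaled 0) f) at_top"
        using narrow_convergence_rescaled by (simp add: narrow_convergence_def)
      then show "((\<lambda>\<beta>. integral\<^sup>L (thermalization \<beta> \<mu>) f) \<longlongrightarrow> integral\<^sup>L (rescaled 0) f) at_top"
        by (rule Lim_transform_eventually) (use thermal in eventually_elim, simp)
    qed
  qed
  moreover have "set_integrable (hausdorff_measure N) E (\<lambda>\<xi>. f (\<xi>, \<xi>) * exp (- \<Phi> \<xi>)) \<and>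
      integral\<^sup>L (rescaled 0) f = (LINT \<xi>:E|hausdorff_measure N. f (\<xi>, \<xi>) * exp (- \<Phi> \<xi>))"
    if f: "bounded_continuous f" for f
  proof -
    have f_meas: "f \<in> borel_measurable borel"
      using f by (auto simp: bounded_continuous_def intro: borel_measurable_continuous_onI)
    then have [measurable]: "f \<in> borel_measurable (borel \<Otimes>\<^sub>M borel)" by (simp add: borel_prod)
    obtain M where M: "\<And>x. \<bar>f x\<bar> \<le> M"
      using f by (auto simp: bounded_continuous_def bounded_real)
    have diag [measurable]: "(\<lambda>\<xi>. f (\<xi>, \<xi>)) \<in> borel_measurable borel" by measurable
    have meas: "(\<lambda>\<xi>. f (\<xi>, \<xi>) * exp (- \<Phi> \<xi>)) \<in> borel_measurable H" by measurable
    have "integrable m (\<lambda>\<xi>. f (\<xi>, \<xi>) * exp (- \<Phi> \<xi>))"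
      using M by (intro integrable_bounded_exp_m[OF diag])
    then have "set_integrable H E (\<lambda>\<xi>. f (\<xi>, \<xi>) * exp (- \<Phi> \<xi>))"
      unfolding m_def by (subst (asm) integrable_measure_restriction[OF _ meas]) simp_all
    moreover have "integral\<^sup>L (rescaled 0) f = (LINT \<xi>:E|H. f (\<xi>, \<xi>) * exp (- \<Phi> \<xi>))"
      unfolding integral_rescaled_0[OF f_meas M]
      unfolding m_def by (rule integral_measure_restriction[OF _ meas]) simp
    ultimately show ?thesis by (simp add: H_def)
  qed
  moreover have "\<exists>C\<^sub>1>0. \<forall>\<^sub>F \<beta> in at_top.
      flat_norm_diff l (thermalization \<beta> \<mu>) (rescaled 0) \<le> ereal (C\<^sub>1 * \<beta> powr (- 1 / 2))"
  proof -
    have "0 \<le> 1 / l" using l by simp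
    from rescaled_lipschitz_estimate[OF this] obtain K where K: "0 < K"
        "\<And>\<epsilon> f. 0 \<le> \<epsilon> \<Longrightarrow> \<epsilon> \<le> 1 \<Longrightarrow> \<epsilon>\<^sup>2 * \<beta>\<^sub>0 \<le> 1 / 2 \<Longrightarrow> (\<And>x. \<bar>f x\<bar> \<le> 1) \<Longrightarrow>
          (\<And>x y. \<bar>f x - f y\<bar> \<le> 1 / l * dist x y) \<Longrightarrow>
          integral\<^sup>L (rescaled \<epsilon>) f - integral\<^sup>L (rescaled 0) f \<le> \<epsilon> * K"
      by meson
    have "\<forall>\<^sub>F \<beta> in at_top.
        flat_norm_diff l (thermalization \<beta> \<mu>) (rescaled 0) \<le> ereal (K * \<beta> powr (- 1 / 2))"
      using thermal scale_small
    proof eventually_elim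
      case (elim \<beta>)
      show ?case
        unfolding flat_norm_diff_def
      proof (rule SUP_least)
        fix f :: "'a \<times> 'a \<Rightarrow> real" assume "f \<in> {f. bounded_lipschitz f \<and> BL_norm l f \<le> 1}"
        then have f: "bounded_lipschitz f" "BL_norm l f \<le> 1" by auto
        show "ereal (integral\<^sup>L (thermalization \<beta> \<mu>) f - integral\<^sup>L (rescaled 0) f) \<le> ereal (K * \<beta> powr (- 1 / 2))"
          using K(2)[OF _ _ _ BL_norm_le_1D[OF f l], of "\<beta> powr (- 1 / 2)"] elim
          by (simp add: mult.commute)
      qed
    qed
    with K(1) show ?thesis by blast
  qed
  ultimately show ?thesis by blast
qed

end
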